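(* Suppose that Assumptions A, B, C, D, E (spelled out in the context) hold, $L<\gamma_{\min}\leq\gamma_k\leq\gamma_{\max}<\infty$ for all $k\geq0$, $0\leq\sigma<(\gamma_{\min}-L)/\gamma_{\min}$, and $\sum_{k=0}^{\infty}\|\Delta^k\|<\infty$. Let $\{\bm{x}^k\}$ be an infinite sequence generated by the iBPDCA with (SC1). If $F$ is a KL function, then the sequence $\{\bm{x}^k\}$ converges to an $\ell$-stationary point of the problem $\min_{\bm{x}\in\mathcal{Q}} f(\bm{x})+P_1(\bm{x})-P_2(\bm{x})$.
   Context: Setting. $\mathbb{E}$ is a real finite-dimensional Euclidean space with inner product $\langle\cdot,\cdot\rangle$ and induced norm $\|\cdot\|$; $\mathcal{Q}\subseteq\mathbb{E}$ is a closed convex set with nonempty interior; the problem is $\min_{\bm{x}\in\mathcal{Q}} f(\bm{x})+P_1(\bm{x})-P_2(\bm{x})$. $\iota_{\mathcal{Q}}$ is the indicator function of $\mathcal{Q}$ ($0$ on $\mathcal{Q}$, $+\infty$ elsewhere). For a proper closed convex function $h$, $\bm{x}\in\mathrm{dom}\,h$ and $\varepsilon\ge 0$, $\partial_\varepsilon h(\bm{x})=\{\bm{d}: h(\bm{y})\ge h(\bm{x})+\langle\bm{d},\bm{y}-\bm{x}\rangle-\varepsilon\ \forall\bm{y}\in\mathbb{E}\}$ and $\partial h=\partial_0 h$. For a general proper function $h$ and $\bm{x}\in\mathrm{dom}\,h$, $\partial h(\bm{x})$ is the limiting subdifferential: the set of $\bm{d}$ for which there are $\bm{x}^k\to\bm{x}$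 with $h(\bm{x}^k)\to h(\bm{x})$ and $\bm{d}^k\to\bm{d}$ with $\liminf_{\bm{y}\to\bm{x}^k,\bm{y}\ne\bm{x}^k}\frac{h(\bm{y})-h(\bm{x}^k)-\langle\bm{d}^k,\bm{y}-\bm{x}^k\rangle}{\|\bm{y}-\bm{x}^k\|}\ge0$ for all $k$ (it coincides with the convex subdifferential for convex $h$). Kernel and Bregman distance. $\phi:\mathbb{E}\to(-\infty,\infty]$ is a proper closed kernel function, and $\mathcal{D}_\phi(\bm{x},\bm{y})=\phi(\bm{x})-\phi(\bm{y})-\langle\nabla\phi(\bm{y}),\bm{x}-\bm{y}\rangle$ for $\bm{x}\in\mathrm{dom}\,\phi$, $\bm{y}\in\mathrm{int}\,\mathrm{dom}\,\phi$. A function $h$ is essentially smooth if $\mathrm{int}\,\mathrm{dom}\,h\neq\emptyset$, $h$ is differentiable on $\mathrm{int}\,\mathrm{dom}\,h$, and $\|\nabla h(\bm{x}^k)\|\to\infty$ for every sequence in $\mathrm{int}\,\mathrm{dom}\,h$ converging to a boundary point of $\mathrm{int}\,\mathrm{dom}\,h$. For a closed set $\mathcal{X}$ with $\mathcal{X}\cap\mathrm{int}\,\mathrm{dom}\,\phi\ne\emptyset$, $(f,\phi)$ is $L$-smooth adaptable restricted on $\mathcal{X}$ ($L\ge 0$) if $|f(\bm{y})-f(\bm{x})-\langle\nabla f(\bm{x}),\bm{y}-\bm{x}\rangle|\le L\mathcal{D}_\phi(\bm{y},\bm{x})$ for all $\bm{x}\in\mathcal{X}\cap\mathrm{int}\,\mathrm{dom}\,\phi$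 and $\bm{y}\in\mathcal{X}\cap\mathrm{dom}\,\phi$. Assumption A. (A1) $\phi$ is essentially smooth and strictly convex on $\mathrm{dom}\,\phi$, and $\overline{\mathrm{dom}\,\phi}=\mathcal{Q}$. (A2) $P_1:\mathbb{E}\to(-\infty,\infty]$ is proper closed convex with $\mathrm{dom}\,P_1\cap\mathrm{int}\,\mathcal{Q}\ne\emptyset$; $P_2:\mathbb{E}\to\mathbb{R}$ is continuous and convex. (A3) $f:\mathbb{E}\to(-\infty,\infty]$ is proper closed (possibly nonconvex) with $\mathrm{dom}\,f\supseteq\mathrm{dom}\,\phi$, $f$ is continuously differentiable on $\mathrm{int}\,\mathrm{dom}\,f$, and there is a closed set $\mathcal{X}\supseteq\mathrm{dom}\,P_1\cap\mathcal{Q}$ such that $(f,\phi)$ is $L$-smooth adaptable restricted on $\mathcal{X}$. (A4) $F:=\iota_{\mathcal{Q}}+P_1-P_2+f$ is level-bounded: $\{\bm{x}: F(\bm{x})\le\alpha\}$ is bounded (possibly empty) for every $\alpha\in\mathbb{R}$. (A5) For each subproblem $\min_{\bm{x}} P_1(\bm{x})+\langle\nabla f(\bm{x}^k)-\bm{\xi}^k,\bm{x}-\bm{x}^k\rangle+\gamma_k\mathcal{D}_\phi(\bm{x},\bm{x}^k)$ of the algorithm below, the set of optimal solutions is nonempty and contained in $\mathrm{int}\,\mathrm{dom}\,\phi$. Assumption B. $f$ is continuously differentiable on an open set $\mathcal{N}_f$ containing $\mathrm{dom}\,P_1\cap\mathcal{Q}$. Assumption C. There is an open set $\mathcal{N}_\phi$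 with $\mathrm{dom}\,P_1\cap\mathcal{Q}\subseteq\mathcal{N}_\phi\subseteq\mathrm{int}\,\mathrm{dom}\,\phi$ such that (C1) $\phi$ is $\mu$-strongly convex on $\mathcal{N}_\phi$ (for some $\mu>0$); (C2) $\phi$ is differentiable on $\mathcal{N}_\phi$ and $\nabla\phi$ is Lipschitz continuous on any bounded subset of $\mathcal{N}_\phi$. Stationarity. $\bm{x}^*$ is a stationary point if $0\in\partial(\iota_{\mathcal{Q}}+P_1)(\bm{x}^* )-\partial P_2(\bm{x}^* )+\nabla f(\bm{x}^* )$; $\mathcal{S}$ denotes the set of all stationary points. If $P_2$ is continuously differentiable near $\bm{x}^*$, then $\bm{x}^*$ is an $\ell$-stationary (limiting stationary) point if $0\in\partial(\iota_{\mathcal{Q}}+P_1)(\bm{x}^* )-\nabla P_2(\bm{x}^* )+\nabla f(\bm{x}^* )$. Assumption D. (D1) $\nabla f$ is Lipschitz continuous on any bounded subset of $\mathcal{N}_f$. (D2) $P_2$ is continuously differentiable on an open set $\mathcal{N}_{\mathcal{S}}$ containing $\mathcal{S}$, and $\nabla P_2$ is locally Lipschitz continuous on $\mathcal{N}_{\mathcal{S}}$. Assumption E. There is $K_0>0$ such that $\delta_k=0$ for all $k\ge K_0$ in the algorithm below. Algorithm (iBPDCA with (SC1)). Choose $\bm{x}^0\in\mathrm{dom}\,P_1\cap\mathrm{int}\,\mathrm{dom}\,\phi$ and parameters $\{\gamma_k\}$, $\sigma$ as in the claim. For $k=0,1,2,\dots$: take any $\bm{\xi}^k\in\partial P_2(\bm{x}^k)$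 and find $\bm{x}^{k+1}\in\mathrm{dom}\,P_1\cap\mathrm{int}\,\mathrm{dom}\,\phi$, $\Delta^k\in\mathbb{E}$ and $\delta_k\ge0$ such that $$\Delta^k\in\partial_{\delta_k}P_1(\bm{x}^{k+1})+\nabla f(\bm{x}^k)-\bm{\xi}^k+\gamma_k\big(\nabla\phi(\bm{x}^{k+1})-\nabla\phi(\bm{x}^k)\big)$$ and (SC1) $\|\Delta^k\|^2+|\langle\Delta^k,\bm{x}^{k+1}-\bm{x}^k\rangle|+\delta_k\le\sigma\gamma_k\mathcal{D}_\phi(\bm{x}^{k+1},\bm{x}^k)$. KL functions. For $\nu>0$, $\Xi_\nu$ is the class of concave functions $\varphi:[0,\nu)\to\mathbb{R}_+$ with $\varphi(0)=0$, $\varphi$ continuously differentiable on $(0,\nu)$ and continuous at $0$, and $\varphi'>0$ on $(0,\nu)$. A proper closed function $h$ has the KL property at $\tilde{\bm{x}}\in\mathrm{dom}\,\partial h:=\{\bm{x}:\partial h(\bm{x})\neq\emptyset\}$ if there are $\nu\in(0,+\infty]$, a neighborhood $\mathcal{V}$ of $\tilde{\bm{x}}$ and $\varphi\in\Xi_\nu$ such that $\varphi'(h(\bm{x})-h(\tilde{\bm{x}}))\,\mathrm{dist}(0,\partial h(\bm{x}))\ge1$ for all $\bm{x}\in\mathcal{V}$ with $h(\tilde{\bm{x}})<h(\bm{x})<h(\tilde{\bm{x}})+\nu$; here $\mathrm{dist}(0,\mathcal{C})=\inf_{\bm{y}\in\mathcal{C}}\|\bm{y}\|$. $h$ is a KL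 function if it has the KL property at each point of $\mathrm{dom}\,\partial h$. *)

theory Defs
  imports "HOL-Analysis.Analysis"
begin

text \<open>
  Functions into the half-open interval from minus infinity (excluded) to plus infinity (included)
  are functions into \<^typ>\<open>ereal\<close> satisfying \<open>proper\<close>, which excludes the value minus infinity.
\<close>

definition edom :: "('a \<Rightarrow> ereal) \<Rightarrow> 'a set" where
  "edom h = {x. h x < \<infinity>}"

definition epi :: "('a \<Rightarrow> ereal) \<Rightarrow> ('a \<times> real) set" where
  "epi h = {(x, t). h x \<le> ereal t}"

definition proper :: "('a \<Rightarrow> ereal) \<Rightarrow> bool" where
  "proper h \<longleftrightarrow> (\<forall>x. h x \<noteq> -\<infinity>) \<and> edom h \<noteq> {}"

definition closed_fun :: "('a::topological_space \<Rightarrow> ereal) \<Rightarrow> bool" where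
  "closed_fun h \<longleftrightarrow> closed (epi h)"

definition convex_fun :: "('a::real_vector \<Rightarrow> ereal) \<Rightarrow> bool" where
  "convex_fun h \<longleftrightarrow> convex (epi h)"

text \<open>
  The strict inequality makes \<open>h\<close> finite on segments, so strict convexity on \<open>edom h\<close> includes
  convexity of \<open>edom h\<close>. In \<open>strongly_convex_on\<close> the set \<open>S\<close> need not be convex: the inequality
  is required for all pairs of points of \<open>S\<close>.
\<close>

definition strictly_convex_on :: "'a::real_vector set \<Rightarrow> ('a \<Rightarrow> ereal) \<Rightarrow> bool" where
  "strictly_convex_on S h \<longleftrightarrow>
     (\<forall>x\<in>S. \<forall>y\<in>S. \<forall>t::real. x \<noteq> y \<longrightarrow> 0 < t \<longrightarrow> t < 1 \<longrightarrow>
        h ((1 - t) *\<^sub>R x + t *\<^sub>R y) < ereal (1 - t) * h x + ereal t * h y)"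

definition strongly_convex_on :: "real \<Rightarrow> 'a::real_normed_vector set \<Rightarrow> ('a \<Rightarrow> ereal) \<Rightarrow> bool" where
  "strongly_convex_on \<mu> S h \<longleftrightarrow>
     (\<forall>x\<in>S. \<forall>y\<in>S. \<forall>t::real. 0 \<le> t \<longrightarrow> t \<le> 1 \<longrightarrow>
        h ((1 - t) *\<^sub>R x + t *\<^sub>R y)
          \<le> ereal (1 - t) * h x + ereal t * h y - ereal (\<mu> / 2 * t * (1 - t) * (norm (x - y))\<^sup>2))"

definition iota :: "'a set \<Rightarrow> 'a \<Rightarrow> ereal" where
  "iota Q x = (if x \<in> Q then 0 else \<infinity>)"

definition level_bounded :: "('a::metric_space \<Rightarrow> ereal) \<Rightarrow> bool" where
  "level_bounded h \<longleftrightarrow> (\<forall>\<alpha>::real. bounded {x. h x \<le> ereal \<alpha>})"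

definition argmin_set :: "('a \<Rightarrow> ereal) \<Rightarrow> 'a set" where
  "argmin_set h = {x. \<forall>y. h x \<le> h y}"

text \<open>
  Since \<^const>\<open>real_of_ereal\<close> maps both infinities to 0, differentiability
  is only meaningful at interior points of the domain; the sets \<open>S\<close> below are always open.
\<close>

definition egrad :: "('a::euclidean_space \<Rightarrow> ereal) \<Rightarrow> 'a \<Rightarrow> 'a" where
  "egrad h x = (THE D. GDERIV (\<lambda>y. real_of_ereal (h y)) x :> D)"

definition ediff_on :: "('a::euclidean_space \<Rightarrow> ereal) \<Rightarrow> 'a set \<Rightarrow> bool" where
  "ediff_on h S \<longleftrightarrow> S \<subseteq> edom h \<and> (\<forall>x\<in>S. (\<lambda>y. real_of_ereal (h y)) differentiable (at x))"

definition eC1_on :: "('a::euclidean_space \<Rightarrow> ereal) \<Rightarrow> 'a set \<Rightarrow> bool" where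
  "eC1_on h S \<longleftrightarrow> ediff_on h S \<and> continuous_on S (egrad h)"

definition lipschitz_on_bounded :: "('a::metric_space \<Rightarrow> 'b::metric_space) \<Rightarrow> 'a set \<Rightarrow> bool" where
  "lipschitz_on_bounded g S \<longleftrightarrow> (\<forall>B\<subseteq>S. bounded B \<longrightarrow> (\<exists>K. K-lipschitz_on B g))"

definition locally_lipschitz_on :: "('a::metric_space \<Rightarrow> 'b::metric_space) \<Rightarrow> 'a set \<Rightarrow> bool" where
  "locally_lipschitz_on g S \<longleftrightarrow> (\<forall>x\<in>S. \<exists>u>0. \<exists>K. K-lipschitz_on (ball x u \<inter> S) g)"

definition essentially_smooth :: "('a::euclidean_space \<Rightarrow> ereal) \<Rightarrow> bool" where
  "essentially_smooth h \<longleftrightarrow>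
     interior (edom h) \<noteq> {} \<and> ediff_on h (interior (edom h)) \<and>
     (\<forall>z a. (\<forall>k. z k \<in> interior (edom h)) \<longrightarrow> a \<in> frontier (interior (edom h)) \<longrightarrow>
        z \<longlonglongrightarrow> a \<longrightarrow> filterlim (\<lambda>k. norm (egrad h (z k))) at_top sequentially)"

definition eps_subdiff :: "real \<Rightarrow> ('a::euclidean_space \<Rightarrow> ereal) \<Rightarrow> 'a \<Rightarrow> 'a set" where
  "eps_subdiff \<epsilon> h x = {d. x \<in> edom h \<and> (\<forall>y. h y \<ge> h x + ereal (d \<bullet> (y - x)) - ereal \<epsilon>)}"

abbreviation convex_subdiff :: "('a::euclidean_space \<Rightarrow> ereal) \<Rightarrow> 'a \<Rightarrow> 'a set" where
  "convex_subdiff h x \<equiv> eps_subdiff 0 h x"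

definition regular_subdiff :: "('a::euclidean_space \<Rightarrow> ereal) \<Rightarrow> 'a \<Rightarrow> 'a set" where
  "regular_subdiff h x = {d. x \<in> edom h \<and>
     Liminf (at x) (\<lambda>y. (h y - h x - ereal (d \<bullet> (y - x))) / ereal (norm (y - x))) \<ge> 0}"

definition limiting_subdiff :: "('a::euclidean_space \<Rightarrow> ereal) \<Rightarrow> 'a \<Rightarrow> 'a set" where
  "limiting_subdiff h x = {d. x \<in> edom h \<and>
     (\<exists>z e. z \<longlonglongrightarrow> x \<and> (\<lambda>k. h (z k)) \<longlonglongrightarrow> h x \<and> e \<longlonglongrightarrow> d \<and>
            (\<forall>k. e k \<in> regular_subdiff h (z k)))}"

text \<open>
  The Bregman distance is kept extended-valued: it is \<open>\<infinity>\<close> for \<open>x\<close> outside the domain of \<open>\<phi>\<close>,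
  as needed in the subproblems, and finite for \<open>x \<in> edom \<phi>\<close>, \<open>y \<in> interior (edom \<phi>)\<close>.
\<close>

definition bregman :: "('a::euclidean_space \<Rightarrow> ereal) \<Rightarrow> 'a \<Rightarrow> 'a \<Rightarrow> ereal" where
  "bregman \<phi> x y = \<phi> x - \<phi> y - ereal (egrad \<phi> y \<bullet> (x - y))"

definition smooth_adaptable ::
  "real \<Rightarrow> ('a::euclidean_space \<Rightarrow> ereal) \<Rightarrow> ('a \<Rightarrow> ereal) \<Rightarrow> 'a set \<Rightarrow> bool" where
  "smooth_adaptable L f \<phi> X \<longleftrightarrow>
     0 \<le> L \<and> closed X \<and> X \<inter> interior (edom \<phi>) \<noteq> {} \<and>
     (\<forall>x \<in> X \<inter> interior (edom \<phi>). \<forall>y \<in> X \<inter> edom \<phi>.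
        \<bar>f y - f x - ereal (egrad f x \<bullet> (y - x))\<bar> \<le> ereal L * bregman \<phi> y x)"

definition objective ::
  "'a set \<Rightarrow> ('a \<Rightarrow> ereal) \<Rightarrow> ('a \<Rightarrow> real) \<Rightarrow> ('a \<Rightarrow> ereal) \<Rightarrow> 'a \<Rightarrow> ereal" where
  "objective Q P1 P2 f x = iota Q x + P1 x - ereal (P2 x) + f x"

definition stationary_points ::
  "'a::euclidean_space set \<Rightarrow> ('a \<Rightarrow> ereal) \<Rightarrow> ('a \<Rightarrow> real) \<Rightarrow> ('a \<Rightarrow> ereal) \<Rightarrow> 'a set" where
  "stationary_points Q P1 P2 f =
     {x. 0 \<in> {u - v + egrad f x | u v.
                u \<in> convex_subdiff (\<lambda>y. iota Q y + P1 y) x \<and>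
                v \<in> convex_subdiff (\<lambda>y. ereal (P2 y)) x}}"

definition l_stationary ::
  "'a::euclidean_space set \<Rightarrow> ('a \<Rightarrow> ereal) \<Rightarrow> ('a \<Rightarrow> real) \<Rightarrow> ('a \<Rightarrow> ereal) \<Rightarrow> 'a \<Rightarrow> bool" where
  "l_stationary Q P1 P2 f x \<longleftrightarrow>
     (\<exists>U. open U \<and> x \<in> U \<and> eC1_on (\<lambda>y. ereal (P2 y)) U) \<and>
     0 \<in> {u - egrad (\<lambda>y. ereal (P2 y)) x + egrad f x | u.
            u \<in> convex_subdiff (\<lambda>y. iota Q y + P1 y) x}"

text \<open>Here \<open>z\<close> is the current iterate and \<open>x\<close> the variable.\<close>

definition subproblem ::
  "('a::euclidean_space \<Rightarrow> ereal) \<Rightarrow> ('a \<Rightarrow> ereal) \<Rightarrow> ('a \<Rightarrow> ereal) \<Rightarrow> 'a \<Rightarrow> 'a \<Rightarrow> real \<Rightarrow> 'a \<Rightarrow> ereal" where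
  "subproblem f P1 \<phi> z \<xi> \<gamma> x =
     P1 x + ereal ((egrad f z - \<xi>) \<bullet> (x - z)) + ereal \<gamma> * bregman \<phi> x z"

definition iBPDCA_SC1 ::
  "('a::euclidean_space \<Rightarrow> ereal) \<Rightarrow> ('a \<Rightarrow> ereal) \<Rightarrow> ('a \<Rightarrow> real) \<Rightarrow> ('a \<Rightarrow> ereal) \<Rightarrow>
   (nat \<Rightarrow> real) \<Rightarrow> real \<Rightarrow> (nat \<Rightarrow> 'a) \<Rightarrow> (nat \<Rightarrow> 'a) \<Rightarrow> (nat \<Rightarrow> 'a) \<Rightarrow> (nat \<Rightarrow> real) \<Rightarrow> bool" where
  "iBPDCA_SC1 f P1 P2 \<phi> \<gamma> \<sigma> x \<xi> \<Delta> \<delta> \<longleftrightarrow>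
     x 0 \<in> edom P1 \<inter> interior (edom \<phi>) \<and>
     (\<forall>k. \<xi> k \<in> convex_subdiff (\<lambda>y. ereal (P2 y)) (x k) \<and>
          x (Suc k) \<in> edom P1 \<inter> interior (edom \<phi>) \<and>
          \<delta> k \<ge> 0 \<and>
          \<Delta> k \<in> {p + egrad f (x k) - \<xi> k + \<gamma> k *\<^sub>R (egrad \<phi> (x (Suc k)) - egrad \<phi> (x k)) | p.
                   p \<in> eps_subdiff (\<delta> k) P1 (x (Suc k))} \<and>
          ereal ((norm (\<Delta> k))\<^sup>2 + \<bar>\<Delta> k \<bullet> (x (Suc k) - x k)\<bar> + \<delta> k)
            \<le> ereal (\<sigma> * \<gamma> k) * bregman \<phi> (x (Suc k)) (x k))"

text \<open>
  The class \<open>\<Xi>\<^sub>\<nu>\<close> of desingularising functions; \<open>\<nu>\<close> may be infinite, and only the values of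
  the function on the interval from 0 (included) to \<open>\<nu>\<close> (excluded) matter.
\<close>

definition Xi_class :: "ereal \<Rightarrow> (real \<Rightarrow> real) set" where
  "Xi_class \<nu> = {\<psi>.
     (\<forall>t. 0 \<le> t \<and> ereal t < \<nu> \<longrightarrow> 0 \<le> \<psi> t) \<and>
     concave_on {t. 0 \<le> t \<and> ereal t < \<nu>} \<psi> \<and>
     \<psi> 0 = 0 \<and>
     (\<forall>t. 0 < t \<and> ereal t < \<nu> \<longrightarrow> \<psi> differentiable (at t)) \<and>
     continuous_on {t. 0 < t \<and> ereal t < \<nu>} (deriv \<psi>) \<and>
     continuous (at 0 within {t. 0 \<le> t \<and> ereal t < \<nu>}) \<psi> \<and>
     (\<forall>t. 0 < t \<and> ereal t < \<nu> \<longrightarrow> 0 < deriv \<psi> t)}"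

text \<open>
  The distance from the origin to the empty set is \<open>\<infinity>\<close>
  (unlike \<^const>\<open>infdist\<close>, which returns 0 there).
\<close>

definition dist0 :: "'a::real_normed_vector set \<Rightarrow> ereal" where
  "dist0 C = (INF y\<in>C. ereal (norm y))"

definition KL_property :: "('a::euclidean_space \<Rightarrow> ereal) \<Rightarrow> 'a \<Rightarrow> bool" where
  "KL_property h a \<longleftrightarrow>
     (\<exists>\<nu>>0. \<exists>V. \<exists>\<psi>\<in>Xi_class \<nu>. open V \<and> a \<in> V \<and>
        (\<forall>x\<in>V. h a < h x \<and> h x < h a + \<nu> \<longrightarrow>
           ereal (deriv \<psi> (real_of_ereal (h x - h a))) * dist0 (limiting_subdiff h x) \<ge> 1))"

definition KL_function :: "('a::euclidean_space \<Rightarrow> ereal) \<Rightarrow> bool" where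
  "KL_function h \<longleftrightarrow> (\<forall>a. limiting_subdiff h a \<noteq> {} \<longrightarrow> KL_property h a)"

end

theory Submission
  imports Defs
begin

text \<open>
  Smooth adaptability and the inexactness criterion make \<open>F\<close> decrease by at least a multiple of
  \<open>\<parallel>x\<^sup>k\<^sup>+\<^sup>1 - x\<^sup>k\<parallel>\<^sup>2\<close>, so the iterates are bounded and their steps tend to 0. Every cluster point \<open>a\<close> is
  stationary with \<open>F a\<close> equal to the limit of the values \<open>F (x\<^sup>k)\<close>. Near \<open>a\<close>, once \<open>\<delta>\<^sub>k = 0\<close>, the
  Lipschitz gradients give a subgradient of \<open>F\<close> at \<open>x\<^sup>k\<^sup>+\<^sup>1\<close> of norm at most
  \<open>b \<parallel>x\<^sup>k\<^sup>+\<^sup>1 - x\<^sup>k\<parallel> + \<parallel>\<Delta>\<^sup>k\<parallel>\<close>. The KL inequality at this single point \<open>a\<close> then bounds the remaining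
  path length, up to the summable errors, by a quantity tending to 0, so the iterates cannot leave
  a neighbourhood of \<open>a\<close> after coming close enough to it.
\<close>

section \<open>Gradients, lower semicontinuity and Bregman distances of extended-valued
  functions\<close>

text \<open>\<open>egrad\<close> is a definite description, so it can be used only after existence
  and uniqueness of the gradient. Existence is the Riesz representation of the derivative, written
  out in the orthonormal \<open>Basis\<close>; uniqueness is that of the Frechet derivative.\<close>

lemma gderiv_egrad:
  assumes "(\<lambda>y. real_of_ereal (h y)) differentiable (at x)"
  shows "GDERIV (\<lambda>y. real_of_ereal (h y)) x :> egrad h x"
proof -
  obtain d where d: "((\<lambda>y. real_of_ereal (h y)) has_derivative d) (at x)"
    using assms by (auto simp: differentiable_def)
  then have lin: "linear d" by (simp add: has_derivative_linear)
  have "d = (\<lambda>v. v \<bullet> (\<Sum>b\<in>Basis. d b *\<^sub>R b))"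
  proof
    fix v
    have "d v = d (\<Sum>b\<in>Basis. (v \<bullet> b) *\<^sub>R b)"
      by (simp add: euclidean_representation)
    also have "\<dots> = (\<Sum>b\<in>Basis. (v \<bullet> b) * d b)"
      using lin by (simp add: linear_sum linear_cmul)
    finally show "d v = v \<bullet> (\<Sum>b\<in>Basis. d b *\<^sub>R b)"
      by (simp add: inner_sum_right mult.commute)
  qed
  with d have ex: "GDERIV (\<lambda>y. real_of_ereal (h y)) x :> (\<Sum>b\<in>Basis. d b *\<^sub>R b)"
    by (simp add: gderiv_def)
  have uniq: "D = D'" if "GDERIV (\<lambda>y. real_of_ereal (h y)) x :> D"
    and "GDERIV (\<lambda>y. real_of_ereal (h y)) x :> D'" for D D'
  proof -
    have "(\<lambda>v. v \<bullet> D) = (\<lambda>v. v \<bullet> D')"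
      using that has_derivative_unique unfolding gderiv_def by blast
    then show ?thesis
      by (metis inner_commute vector_eq_rdot)
  qed
  show ?thesis
    unfolding egrad_def by (rule theI2[where P="\<lambda>D. GDERIV (\<lambda>y. real_of_ereal (h y)) x :> D", OF ex])
      (auto intro: uniq ex)
qed

lemma gradient_estimate:
  fixes g :: "'a::euclidean_space \<Rightarrow> real"
  assumes "GDERIV g x :> D" "0 < \<epsilon>"
  shows "\<forall>\<^sub>F y in at x. \<bar>g y - g x - D \<bullet> (y - x)\<bar> \<le> \<epsilon> * norm (y - x)"
proof -
  have "(g has_derivative (\<lambda>v. v \<bullet> D)) (at x within UNIV)"
    using assms by (simp add: gderiv_def)
  then obtain d where "d > 0"
    "\<forall>y. norm (y - x) < d \<longrightarrow> norm (g y - g x - (y - x) \<bullet> D) \<le> \<epsilon> * norm (y - x)"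
    using assms(2) unfolding has_derivative_within_alt by auto
  then show ?thesis
    unfolding eventually_at by (intro exI[of _ d]) (auto simp: dist_norm inner_commute)
qed

text \<open>Lower semicontinuity along a sequence: the complement of the closed epigraph is open and
  contains \<open>(a, t)\<close>, hence also \<open>(z n, t)\<close> eventually.\<close>

lemma closed_fun_lsc:
  assumes "closed_fun h" "z \<longlonglongrightarrow> a" "ereal t < h a"
  shows "\<forall>\<^sub>F n in sequentially. ereal t < h (z n)"
proof -
  have "open (- epi h)" "(a, t) \<in> - epi h"
    using assms by (auto simp: closed_fun_def epi_def)
  moreover have "(\<lambda>n. (z n, t)) \<longlonglongrightarrow> (a, t)"
    by (intro tendsto_Pair assms tendsto_const)
  ultimately have "\<forall>\<^sub>F n in sequentially. (z n, t) \<in> - epi h"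
    using topological_tendstoD by blast
  then show ?thesis by (simp add: epi_def not_le)
qed

lemma ediff_on_finite:
  assumes "ediff_on h N" "x \<in> N" "h x \<noteq> -\<infinity>"
  shows "h x = ereal (real_of_ereal (h x))"
  using assms by (cases "h x") (auto simp: ediff_on_def edom_def)

text \<open>Strong convexity along the segment from \<open>y\<close> to \<open>x\<close> bounds the
  difference quotient of \<open>\<phi>\<close> at \<open>y\<close>; letting the parameter tend to 0
  from the right turns the quotient into the directional derivative.\<close>

lemma bregman_lower_bound:
  assumes conv: "strongly_convex_on \<mu> N \<phi>" and diff: "ediff_on \<phi> N"
    and noninf: "\<And>z. \<phi> z \<noteq> -\<infinity>" and xy: "x \<in> N" "y \<in> N"
  shows "\<mu> / 2 * (norm (x - y))\<^sup>2
    \<le> real_of_ereal (\<phi> x) - real_of_ereal (\<phi> y) - egrad \<phi> y \<bullet> (x - y)"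
proof -
  define p where "p = (\<lambda>z. real_of_ereal (\<phi> z))"
  define q where "q t = p (y + t *\<^sub>R (x - y))" for t :: real
  have fin: "\<phi> x = ereal (p x)" "\<phi> y = ereal (p y)"
    using ediff_on_finite[OF diff _ noninf] xy by (auto simp: p_def)
  have le: "(q t - q 0) / t \<le> p x - p y - \<mu> / 2 * (1 - t) * (norm (x - y))\<^sup>2"
    if t: "0 < t" "t < 1" for t
  proof -
    have "\<phi> ((1 - t) *\<^sub>R y + t *\<^sub>R x)
        \<le> ereal (1 - t) * \<phi> y + ereal t * \<phi> x - ereal (\<mu> / 2 * t * (1 - t) * (norm (y - x))\<^sup>2)"
      using conv xy t unfolding strongly_convex_on_def by auto
    moreover have "(1 - t) *\<^sub>R y + t *\<^sub>R x = y + t *\<^sub>R (x - y)"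
      by (simp add: algebra_simps)
    ultimately have *: "\<phi> (y + t *\<^sub>R (x - y))
        \<le> ereal ((1 - t) * p y + t * p x - \<mu> / 2 * t * (1 - t) * (norm (x - y))\<^sup>2)"
      by (simp add: fin norm_minus_commute)
    \<comment> \<open>\<open>N\<close> need not be convex, so this point may lie outside it. The
      bound just shown excludes the value \<open>\<infinity>\<close>, and \<open>noninf\<close>
      excludes \<open>-\<infinity>\<close>.\<close>
    moreover have "\<phi> (y + t *\<^sub>R (x - y)) = ereal (q t)"
      using * noninf[of "y + t *\<^sub>R (x - y)"] unfolding q_def p_def
      by (cases "\<phi> (y + t *\<^sub>R (x - y))") auto
    ultimately have "q t \<le> (1 - t) * p y + t * p x - \<mu> / 2 * t * (1 - t) * (norm (x - y))\<^sup>2"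
      by simp
    moreover have "q 0 = p y" by (simp add: q_def)
    ultimately have "q t - q 0 \<le> (p x - p y - \<mu> / 2 * (1 - t) * (norm (x - y))\<^sup>2) * t"
      by (simp add: algebra_simps)
    then show ?thesis using t(1) by (simp add: pos_divide_le_eq)
  qed
  have "GDERIV p y :> egrad \<phi> y"
    using diff xy(2) gderiv_egrad unfolding ediff_on_def p_def by blast
  then have d: "(p has_derivative (\<lambda>v. v \<bullet> egrad \<phi> y)) (at (y + 0 *\<^sub>R (x - y)))"
    by (simp add: gderiv_def)
  have "((\<lambda>t. y + t *\<^sub>R (x - y)) has_derivative (\<lambda>t. t *\<^sub>R (x - y))) (at 0)"
    by (auto intro!: derivative_eq_intros)
  from diff_chain_at[OF this, of p, OF d]
  have "(q has_derivative (\<lambda>t. (t *\<^sub>R (x - y)) \<bullet> egrad \<phi> y)) (at 0)"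
    by (simp add: o_def q_def[abs_def])
  then have "(q has_field_derivative (egrad \<phi> y \<bullet> (x - y))) (at 0)"
    by (rule has_derivative_imp_has_field_derivative) (simp add: inner_commute)
  then have "(q has_field_derivative (egrad \<phi> y \<bullet> (x - y))) (at_right 0)"
    by (rule DERIV_subset) simp
  then have "((\<lambda>t. (q t - q 0) / t) \<longlongrightarrow> egrad \<phi> y \<bullet> (x - y)) (at_right 0)"
    unfolding has_field_derivative_iff by simp
  moreover have "((\<lambda>t. p x - p y - \<mu> / 2 * (1 - t) * (norm (x - y))\<^sup>2)
      \<longlongrightarrow> p x - p y - \<mu> / 2 * (1 - 0) * (norm (x - y))\<^sup>2) (at_right 0)"
    by (intro tendsto_intros)
  moreover have "\<forall>\<^sub>F t in at_right 0. (q t - q 0) / t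
      \<le> p x - p y - \<mu> / 2 * (1 - t) * (norm (x - y))\<^sup>2"
    unfolding eventually_at_right_field using le by (intro exI[of _ 1]) auto
  ultimately have "egrad \<phi> y \<bullet> (x - y) \<le> p x - p y - \<mu> / 2 * (1 - 0) * (norm (x - y))\<^sup>2"
    using tendsto_le[OF trivial_limit_at_right_real] by blast
  then show ?thesis by (simp add: p_def)
qed

section \<open>Convex, regular and limiting subgradients\<close>

lemma convex_subdiff_real_iff:
  "d \<in> convex_subdiff (\<lambda>y. ereal (g y)) x \<longleftrightarrow> (\<forall>y. g x + d \<bullet> (y - x) \<le> g y)"
  by (auto simp: eps_subdiff_def edom_def)

text \<open>Subtracting the affine minorant with slope \<open>d\<close> leaves a function minimal at
  \<open>x\<close>, so its derivative there vanishes.\<close>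

lemma convex_subdiff_eq_egrad:
  assumes "d \<in> convex_subdiff (\<lambda>y. ereal (g y)) x" "g differentiable (at x)"
  shows "d = egrad (\<lambda>y. ereal (g y)) x"
proof -
  let ?D = "egrad (\<lambda>y. ereal (g y)) x"
  have "(g has_derivative (\<lambda>v. v \<bullet> ?D)) (at x)"
    using gderiv_egrad[of "\<lambda>y. ereal (g y)" x] assms(2) by (simp add: gderiv_def)
  then have "((\<lambda>y. g y - d \<bullet> (y - x)) has_derivative (\<lambda>v. v \<bullet> ?D - d \<bullet> v)) (at x)"
    by (auto intro!: derivative_eq_intros)
  moreover have "g x - d \<bullet> (x - x) \<le> g y - d \<bullet> (y - x)" for y
    using assms(1) by (simp add: convex_subdiff_real_iff algebra_simps)
  ultimately have "(\<lambda>v. v \<bullet> ?D - d \<bullet> v) = (\<lambda>v. 0)"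
    by (intro has_derivative_local_min) auto
  \<comment> \<open>Evaluating the zero derivative at \<open>?D - d\<close> itself produces the
    squared norm of \<open>?D - d\<close>.\<close>
  then have "(?D - d) \<bullet> ?D - d \<bullet> (?D - d) = 0" by meson
  then have "(?D - d) \<bullet> (?D - d) = 0" by (simp add: inner_diff inner_commute)
  then show ?thesis by simp
qed

text \<open>The subgradient inequality tested at the unit step \<open>x + sgn d\<close> gives
  \<open>norm d \<le> g (x + sgn d) - g x\<close>. All points involved lie in one compact ball, on
  which \<open>g\<close> is bounded.\<close>

lemma convex_subdiff_bounded:
  fixes g :: "'a::euclidean_space \<Rightarrow> real"
  assumes "continuous_on UNIV g" "bounded B"
  shows "bounded (\<Union>x\<in>B. convex_subdiff (\<lambda>y. ereal (g y)) x)"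
proof -
  obtain R where R: "\<And>x. x \<in> B \<Longrightarrow> norm x \<le> R"
    using assms(2) by (auto simp: bounded_iff)
  have "bounded (g ` cball 0 (R + 1))"
    using assms(1) by (intro compact_imp_bounded compact_continuous_image)
      (auto intro: continuous_on_subset)
  then obtain M where M: "\<And>x. norm x \<le> R + 1 \<Longrightarrow> \<bar>g x\<bar> \<le> M"
    by (force simp: bounded_iff)
  have "norm d \<le> 2 * M" if x: "x \<in> B" and d: "d \<in> convex_subdiff (\<lambda>y. ereal (g y)) x" for x d
  proof -
    have "norm (sgn d) \<le> 1" by (simp add: norm_sgn)
    then have "norm (x + sgn d) \<le> R + 1"
      using R[OF x] norm_triangle_ineq[of x "sgn d"] by linarith
    moreover have "norm x \<le> R + 1" using R[OF x] by simp
    ultimately have "\<bar>g (x + sgn d)\<bar> \<le> M" "\<bar>g x\<bar> \<le> M" using M by blast+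
    moreover have "g x + d \<bullet> (x + sgn d - x) \<le> g (x + sgn d)"
      using d unfolding convex_subdiff_real_iff by blast
    moreover have "d \<bullet> sgn d = norm d"
      by (cases "d = 0") (simp_all add: sgn_div_norm dot_square_norm power2_eq_square)
    ultimately show ?thesis by simp
  qed
  then show ?thesis unfolding bounded_iff by blast
qed

lemma regular_subset_limiting: "regular_subdiff h x \<subseteq> limiting_subdiff h x"
proof
  fix d assume d: "d \<in> regular_subdiff h x"
  then show "d \<in> limiting_subdiff h x"
    unfolding limiting_subdiff_def mem_Collect_eq
    by (intro conjI exI[where x="\<lambda>_. x"] exI[where x="\<lambda>_. d"]) (auto simp: regular_subdiff_def)
qed

text \<open>Replaces the \<open>Liminf\<close> of extended-real quotients by the first-order
  inequality with error \<open>\<epsilon> * norm (y - x)\<close>, which can be checked term by term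
  for sums.\<close>

lemma regular_subdiffI:
  assumes hx: "h x = ereal r"
    and ev: "\<And>\<epsilon>. 0 < \<epsilon> \<Longrightarrow> \<forall>\<^sub>F y in at x. h y \<ge> ereal (r + d \<bullet> (y - x) - \<epsilon> * norm (y - x))"
  shows "d \<in> regular_subdiff h x"
proof -
  have "\<forall>\<^sub>F y in at x. c < (h y - h x - ereal (d \<bullet> (y - x))) / ereal (norm (y - x))"
    if c: "c < 0" for c
  proof -
    \<comment> \<open>\<open>e\<close> passes from the extended-real level \<open>c\<close> to a
      real tolerance: half of \<open>- c\<close> if \<open>c\<close> is real, and 1 if
      \<open>c\<close> is \<open>-\<infinity>\<close>.\<close>
    obtain e where e: "0 < e" "c < ereal (- e)"
    proof (cases c)
      case (real u)
      with c show ?thesis by (intro that[of "- u / 2"]) auto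
    qed (use c that[of 1] in auto)
    have "\<forall>\<^sub>F y in at x. y \<noteq> x" by (simp add: eventually_at_filter)
    with ev[OF e(1)] show ?thesis
    proof eventually_elim
      case (elim y)
      have n: "norm (y - x) > 0" using elim by simp
      show ?case
      proof (cases "h y")
        case (real u)
        then have "u - r - d \<bullet> (y - x) \<ge> - e * norm (y - x)" using elim(1) by simp
        then have "- e \<le> (u - r - d \<bullet> (y - x)) / norm (y - x)"
          using n by (simp add: field_simps)
        then have "ereal (- e) \<le> (h y - h x - ereal (d \<bullet> (y - x))) / ereal (norm (y - x))"
          using n real hx by simp
        then show ?thesis using e(2) by (rule order.strict_trans2[rotated])
      next
        case PInf
        then have "(h y - h x - ereal (d \<bullet> (y - x))) / ereal (norm (y - x)) = \<infinity>"
          using n hx by simp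
        then show ?thesis using e(2) by (cases c) auto
      qed (use elim(1) in auto)
    qed
  qed
  then show ?thesis
    by (auto simp: regular_subdiff_def edom_def hx le_Liminf_iff)
qed

text \<open>A sum rule proved directly. \<open>P1\<close> contributes its global affine minorant,
  the indicator can only raise the value, and the first-order expansions of \<open>f\<close> and
  \<open>P2\<close> each cost half of \<open>\<epsilon>\<close>.\<close>

lemma regular_subdiff_objective:
  assumes p: "p \<in> convex_subdiff P1 x" and x: "x \<in> Q" "P1 x = ereal r"
    and f: "open N" "x \<in> N" "ediff_on f N" "\<And>y. f y \<noteq> -\<infinity>"
    and P2: "P2 differentiable (at x)"
  shows "p - egrad (\<lambda>y. ereal (P2 y)) x + egrad f x \<in> regular_subdiff (objective Q P1 P2 f) x"
    (is "?w \<in> _")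
proof -
  define fr where "fr = (\<lambda>y. real_of_ereal (f y))"
  have fN: "f y = ereal (fr y)" if "y \<in> N" for y
    using ediff_on_finite[OF f(3) that f(4)] by (simp add: fr_def)
  have gf: "GDERIV fr x :> egrad f x"
    using f(2,3) gderiv_egrad unfolding ediff_on_def fr_def by blast
  have gP2: "GDERIV P2 x :> egrad (\<lambda>y. ereal (P2 y)) x"
    using gderiv_egrad[of "\<lambda>y. ereal (P2 y)" x] P2 by simp
  have "objective Q P1 P2 f x = ereal (r - P2 x + fr x)"
    using x fN[OF f(2)] by (simp add: objective_def iota_def)
  moreover have "\<forall>\<^sub>F y in at x. objective Q P1 P2 f y
      \<ge> ereal ((r - P2 x + fr x) + ?w \<bullet> (y - x) - \<epsilon> * norm (y - x))" if "\<epsilon> > 0" for \<epsilon>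
  proof -
    have e: "\<epsilon> / 2 > 0" using that by simp
    have "\<forall>\<^sub>F y in at x. y \<in> N" using f(1,2) by (rule eventually_at_in_open')
    with gradient_estimate[OF gf e] gradient_estimate[OF gP2 e]
    show ?thesis
    proof eventually_elim
      case (elim y)
      have "P1 y \<ge> ereal (r + p \<bullet> (y - x))"
        using p x(2) by (simp add: eps_subdiff_def)
      moreover have "iota Q y \<ge> 0" by (simp add: iota_def)
      ultimately have "iota Q y + P1 y \<ge> 0 + ereal (r + p \<bullet> (y - x))" by (rule add_mono[rotated])
      then have "objective Q P1 P2 f y \<ge> ereal (r + p \<bullet> (y - x)) - ereal (P2 y) + ereal (fr y)"
        unfolding objective_def fN[OF elim(3)] by (intro add_mono ereal_minus_mono) auto
      moreover have "r + p \<bullet> (y - x) - P2 y + fr y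
          \<ge> (r - P2 x + fr x) + ?w \<bullet> (y - x) - \<epsilon> * norm (y - x)"
        using elim(1,2) unfolding inner_add_left inner_diff_left abs_le_iff by argo
      ultimately show ?case
        by (metis (no_types, lifting) ereal_less_eq(3) ereal_minus(1) order_trans plus_ereal.simps(1))
    qed
  qed
  ultimately show ?thesis by (rule regular_subdiffI)
qed

section \<open>Convergence of descent sequences under the KL inequality\<close>

text \<open>
  The potential \<open>E k\<close> dominates the remaining path length, so \<open>dist (x (Suc k)) a + E k\<close> is
  nonincreasing as long as the iterates stay in the ball; once small, it keeps them there.
\<close>

lemma trapped_sequence_converges:
  fixes x :: "nat \<Rightarrow> 'a::metric_space"
  assumes sub: "strict_mono s" "(x \<circ> s) \<longlonglongrightarrow> a" and \<rho>: "\<rho> > 0"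
    and E: "E \<longlonglongrightarrow> 0" "\<And>k. k \<ge> K \<Longrightarrow> dist (x k) (x (Suc k)) \<le> E k"
    and step: "\<And>k. k \<ge> K \<Longrightarrow> x k \<in> ball a \<rho> \<Longrightarrow> x (Suc k) \<in> ball a \<rho> \<Longrightarrow>
      dist (x (Suc k)) (x (Suc (Suc k))) + E (Suc k) \<le> E k"
  shows "x \<longlonglongrightarrow> a"
proof (rule metric_LIMSEQ_I)
  fix e :: real assume e: "e > 0"
  define r where "r = min e \<rho>"
  have r: "r > 0" "r \<le> \<rho>" "r \<le> e" using e \<rho> by (auto simp: r_def)
  have E0: "0 \<le> E k" if "k \<ge> K" for k using that E(2)[of k] zero_le_dist order_trans by blast
  \<comment> \<open>With both \<open>E n\<close> and \<open>dist (x n) a\<close> below a quarter of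
    \<open>r\<close>, the sum \<open>dist (x (Suc n)) a + E n\<close> starts below three quarters of
    \<open>r\<close>, because the step out of \<open>x n\<close> costs at most another
    \<open>E n\<close>.\<close>
  have "\<forall>\<^sub>F k in sequentially. E k < r / 4"
    using E(1) r(1) by (intro order_tendstoD) auto
  then obtain K1 where K1: "\<And>k. k \<ge> K1 \<Longrightarrow> E k < r / 4" by (auto simp: eventually_sequentially)
  have "\<forall>\<^sub>F j in sequentially. dist (x (s j)) a < r / 4"
    using tendstoD[OF sub(2), of "r / 4"] r(1) by simp
  moreover have "\<forall>\<^sub>F j in sequentially. max K K1 \<le> j" by (rule eventually_ge_at_top)
  ultimately have "\<forall>\<^sub>F j in sequentially. dist (x (s j)) a < r / 4 \<and> max K K1 \<le> j"
    by (rule eventually_conj)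
  then obtain j where j: "dist (x (s j)) a < r / 4" "max K K1 \<le> j"
    using eventually_happens by fastforce
  define n where "n = s j"
  have n: "n \<ge> K" "n \<ge> K1" using j(2) strict_mono_imp_increasing[OF sub(1), of j]
    by (auto simp: n_def)
  have xn: "dist (x n) a < r / 4" using j(1) by (simp add: n_def)
  \<comment> \<open>The invariant speaks of two consecutive iterates because \<open>step\<close>
    requires both of them in the ball.\<close>
  have inv: "dist (x k) a < r \<and> dist (x (Suc k)) a + E k < r" if "k \<ge> n" for k
    using that
  proof (induction k rule: dec_induct)
    case base
    have "dist (x (Suc n)) a \<le> E n + dist (x n) a"
      using dist_triangle2[of "x (Suc n)" a "x n"] E(2)[OF n(1)]
        dist_triangle[of "x (Suc n)" a "x n"] by (simp add: dist_commute)
    then show ?case using xn K1[OF n(2)] r(1) by linarith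
  next
    case (step k)
    have 1: "dist (x (Suc k)) a < r" using step.IH E0[of k] n(1) step.hyps by linarith
    have "dist (x (Suc k)) (x (Suc (Suc k))) + E (Suc k) \<le> E k"
    proof (rule assms(6))
      show "K \<le> k" using n(1) step.hyps by simp
      show "x k \<in> ball a \<rho>" "x (Suc k) \<in> ball a \<rho>"
        using step.IH 1 r(2) by (auto simp: dist_commute)
    qed
    moreover have "dist (x (Suc (Suc k))) a \<le> dist (x (Suc k)) (x (Suc (Suc k))) + dist (x (Suc k)) a"
      using dist_triangle[of "x (Suc (Suc k))" a "x (Suc k)"] by (simp add: dist_commute)
    ultimately show ?case using 1 step.IH by linarith
  qed
  show "\<exists>no. \<forall>k\<ge>no. dist (x k) a < e"
    using inv r(3) by (intro exI[of _ n]) force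
qed

text \<open>A concave function lies below its tangent at \<open>t\<close>; the library fact is
  stated for convex functions, hence the passage to the negative of \<open>\<psi>\<close>. This
  converts a decrease of function values into a decrease of \<open>\<psi>\<close>.\<close>

lemma Xi_class_tangent:
  assumes \<psi>: "\<psi> \<in> Xi_class \<nu>" and t: "0 < t" "ereal t < \<nu>" and u: "0 \<le> u" "u \<le> t"
  shows "deriv \<psi> t * (t - u) \<le> \<psi> t - \<psi> u"
proof -
  define A where "A = {t. 0 \<le> t \<and> ereal t < \<nu>}"
  have conv: "convex_on A (\<lambda>t. - \<psi> t)"
    using \<psi> by (simp add: Xi_class_def concave_on_def A_def)
  have "open {t. ereal t < \<nu>}"
    by (intro open_Collect_less continuous_intros)
  then have "open ({0<..} \<inter> {t. ereal t < \<nu>})" by (intro open_Int) auto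
  moreover have "{0<..} \<inter> {t. ereal t < \<nu>} \<subseteq> A" by (auto simp: A_def)
  moreover have "t \<in> {0<..} \<inter> {t. ereal t < \<nu>}" using t by simp
  ultimately have int: "t \<in> interior A" by (meson interiorI)
  have "u \<in> A"
    using u t by (auto simp: A_def intro: le_less_trans[of "ereal u" "ereal t"])
  have "\<psi> differentiable (at t)" using \<psi> t by (simp add: Xi_class_def)
  then have "(\<psi> has_field_derivative deriv \<psi> t) (at t)"
    by (simp add: DERIV_deriv_iff_real_differentiable)
  then have "((\<lambda>t. - \<psi> t) has_field_derivative - deriv \<psi> t) (at t within A)"
    by (intro DERIV_minus) (rule has_field_derivative_at_within)
  from convex_on_imp_above_tangent[OF conv convex_connected[OF convex_on_imp_convex[OF conv]] int \<open>u \<in> A\<close> this]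
  show ?thesis by (simp add: algebra_simps)
qed

lemma two_mul_le_add_of_power2_le_mult:
  fixes u v w :: real
  assumes "u\<^sup>2 \<le> v * w" "0 \<le> v" "0 \<le> w"
  shows "2 * u \<le> v + w"
proof (rule power2_le_imp_le)
  have "(v + w)\<^sup>2 = (v - w)\<^sup>2 + 4 * (v * w)" by (simp add: power2_eq_square algebra_simps)
  moreover have "(2 * u)\<^sup>2 = 4 * u\<^sup>2" by (simp add: power_mult_distrib)
  ultimately show "(2 * u)\<^sup>2 \<le> (v + w)\<^sup>2"
    using assms(1) zero_le_power2[of "v - w"] by linarith
qed (use assms in simp)

text \<open>The gaps of the convergent sequence \<open>v\<close> tend to 0 and dominate
  \<open>c\<close> times the squared steps.\<close>

lemma null_steps_of_descent:
  fixes x :: "nat \<Rightarrow> 'a::metric_space"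
  assumes v: "v \<longlonglongrightarrow> \<zeta>" and descent: "c > 0"
    "\<And>k. v (Suc k) + c * (dist (x k) (x (Suc k)))\<^sup>2 \<le> v k"
  shows "(\<lambda>k. dist (x k) (x (Suc k))) \<longlonglongrightarrow> 0"
proof -
  have "(\<lambda>k. (v k - v (Suc k)) / c) \<longlonglongrightarrow> (\<zeta> - \<zeta>) / c"
    using v descent(1) by (intro tendsto_intros) (auto simp: filterlim_sequentially_Suc)
  then have gap: "(\<lambda>k. (v k - v (Suc k)) / c) \<longlonglongrightarrow> 0" by simp
  have "(dist (x k) (x (Suc k)))\<^sup>2 \<le> (v k - v (Suc k)) / c" for k
    using descent(1) descent(2)[of k] by (simp add: pos_le_divide_eq mult.commute)
  then have "(\<lambda>k. (dist (x k) (x (Suc k)))\<^sup>2) \<longlonglongrightarrow> 0"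
    by (intro real_tendsto_sandwich[OF _ _ tendsto_const gap]) auto
  from tendsto_real_sqrt[OF this] show ?thesis by simp
qed

text \<open>The abstract KL argument. Decrease, subgradient bound and tangent inequality bound each
  squared step by a decrease of \<open>\<psi>\<close> times the previous step plus error. The
  inequality of arithmetic and geometric means makes this linear, so it telescopes.\<close>

lemma KL_descent_converges:
  fixes x :: "nat \<Rightarrow> 'a::euclidean_space"
  assumes h: "h a = ereal \<zeta>" "\<And>k. h (x k) = ereal (v k)"
    and sub: "strict_mono s" "(x \<circ> s) \<longlonglongrightarrow> a" and v: "v \<longlonglongrightarrow> \<zeta>"
    and descent: "c > 0" "\<And>k. v (Suc k) + c * (dist (x k) (x (Suc k)))\<^sup>2 \<le> v k"
    and KL: "KL_property h a"
    and e: "summable e" "\<And>k. 0 \<le> e k" and "\<rho> > 0" "b > 0"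
    and w: "\<And>k. k \<ge> K \<Longrightarrow> x k \<in> ball a \<rho> \<Longrightarrow> x (Suc k) \<in> ball a \<rho> \<Longrightarrow>
      \<exists>w\<in>limiting_subdiff h (x (Suc k)). norm w \<le> b * dist (x k) (x (Suc k)) + e k"
  shows "x \<longlonglongrightarrow> a"
proof -
  define d where "d k = dist (x k) (x (Suc k))" for k
  define r where "r k = v k - \<zeta>" for k
  have desc: "c * (d k)\<^sup>2 \<le> r k - r (Suc k)" for k
    using descent(2)[of k] by (simp add: d_def r_def)
  have "decseq v"
  proof (rule decseq_SucI)
    fix k
    have "0 \<le> c * (d k)\<^sup>2" using descent(1) by simp
    then show "v (Suc k) \<le> v k" using desc[of k] by (simp add: r_def)
  qed
  then have r0: "0 \<le> r k" for k using v decseq_ge by (simp add: r_def)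
  have r_lim: "r \<longlonglongrightarrow> 0" using v unfolding r_def by (simp add: LIM_zero)
  have d_lim: "d \<longlonglongrightarrow> 0"
    unfolding d_def[abs_def] using v descent by (rule null_steps_of_descent)
  obtain \<nu> V \<psi> where \<nu>: "\<nu> > 0" and \<psi>: "\<psi> \<in> Xi_class \<nu>" and V: "open V" "a \<in> V"
    and KL': "\<And>y. y \<in> V \<Longrightarrow> h a < h y \<Longrightarrow> h y < h a + \<nu> \<Longrightarrow>
      1 \<le> ereal (deriv \<psi> (real_of_ereal (h y - h a))) * dist0 (limiting_subdiff h y)"
    using KL unfolding KL_property_def by blast
  obtain \<rho>' where \<rho>': "\<rho>' > 0" "ball a \<rho>' \<subseteq> V"
    using V openE by blast
  have "(\<lambda>k. ereal (r k)) \<longlonglongrightarrow> 0" using r_lim by (simp add: zero_ereal_def)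
  then have "\<forall>\<^sub>F k in sequentially. ereal (r k) < \<nu>" using \<nu> by (rule order_tendstoD)
  then obtain K1 where K1: "\<And>k. k \<ge> K1 \<Longrightarrow> ereal (r k) < \<nu>"
    by (auto simp: eventually_sequentially)
  have \<psi>0: "0 \<le> \<psi> (r k)" if "k \<ge> K1" for k
    using \<psi> r0[of k] K1[OF that] by (simp add: Xi_class_def)
  have "continuous (at 0 within {t. 0 \<le> t \<and> ereal t < \<nu>}) \<psi>" "\<psi> 0 = 0"
    using \<psi> by (auto simp: Xi_class_def)
  moreover have "\<forall>\<^sub>F k in sequentially. r k \<in> {t. 0 \<le> t \<and> ereal t < \<nu>}"
    using r0 K1 by (auto simp: eventually_sequentially)
  ultimately have \<psi>_lim: "(\<lambda>k. \<psi> (r k)) \<longlonglongrightarrow> 0"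
    using continuous_within_tendsto_compose[of 0 _ \<psi> r sequentially] r_lim by fastforce
  \<comment> \<open>The tail of the error series from index \<open>k\<close> on, scaled by
    \<open>b\<close>.\<close>
  define T where "T k = (suminf e - (\<Sum>i<k. e i)) / b" for k
  have T0: "0 \<le> T k" for k
    using sum_le_suminf[of e "{..<k}"] e \<open>b > 0\<close> by (simp add: T_def)
  have T_Suc: "T k = e k / b + T (Suc k)" for k
    by (simp add: T_def diff_divide_distrib add_divide_distrib)
  have "T \<longlonglongrightarrow> (suminf e - suminf e) / b"
    unfolding T_def using \<open>b > 0\<close> by (intro tendsto_intros summable_LIMSEQ e) auto
  then have T_lim: "T \<longlonglongrightarrow> 0" by simp
  \<comment> \<open>The potential for \<open>trapped_sequence_converges\<close>: current step,
    desingularised gap at the next iterate, and remaining errors. The index \<open>Suc k\<close> in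
    the middle term matches the subgradient bound, which controls a subgradient at
    \<open>x (Suc k)\<close> by the step \<open>d k\<close>.\<close>
  define E where "E k = d k + b / c * \<psi> (r (Suc k)) + T k" for k
  show ?thesis
  proof (rule trapped_sequence_converges[OF sub])
    show "min \<rho> \<rho>' > 0" using \<open>\<rho> > 0\<close> \<rho>'(1) by simp
    have "E \<longlonglongrightarrow> 0 + b / c * 0 + 0"
      unfolding E_def using \<psi>_lim
      by (intro tendsto_intros d_lim T_lim) (simp add: filterlim_sequentially_Suc[of "\<lambda>k. \<psi> (r k)"])
    then show "E \<longlonglongrightarrow> 0" by simp
    show "dist (x k) (x (Suc k)) \<le> E k" if "k \<ge> max K K1" for k
    proof -
      have "0 \<le> b / c * \<psi> (r (Suc k))"
        using that \<psi>0[of "Suc k"] \<open>b > 0\<close> descent(1) by (intro mult_nonneg_nonneg) auto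
      then show ?thesis using T0[of k] by (simp add: E_def d_def)
    qed
    fix k assume k: "k \<ge> max K K1"
      and ball: "x k \<in> ball a (min \<rho> \<rho>')" "x (Suc k) \<in> ball a (min \<rho> \<rho>')"
    define j where "j = Suc k"
    have j: "ereal (r j) < \<nu>" "0 \<le> r (Suc j)" "r (Suc j) \<le> r j"
      using K1[of j] k r0 \<open>decseq v\<close> by (auto simp: j_def r_def decseq_Suc_iff)
    \<comment> \<open>The second conjunct provides the sign needed to apply the mean inequality to
      the two factors.\<close>
    have "(d j)\<^sup>2 \<le> (b / c * (\<psi> (r j) - \<psi> (r (Suc j)))) * (d k + e k / b)
      \<and> \<psi> (r (Suc j)) \<le> \<psi> (r j)"
    proof (cases "r j = 0")
      \<comment> \<open>The KL inequality says nothing at the limit value, but then the decrease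
        condition itself forces the step to be 0.\<close>
      case True
      then have "r (Suc j) = 0" using j by linarith
      moreover have "c * (d j)\<^sup>2 \<le> 0" using desc[of j] True j by linarith
      then have "d j = 0" using descent(1)
        by (metis mult_le_cancel_left_pos mult_zero_right power2_less_eq_zero_iff)
      ultimately show ?thesis using True by simp
    next
      case False
      then have rj: "0 < r j" using r0[of j] by simp
      have pos: "0 < deriv \<psi> (r j)" using \<psi> rj j(1) by (simp add: Xi_class_def)
      obtain w where w: "w \<in> limiting_subdiff h (x j)" "norm w \<le> b * d k + e k"
        using w[of k] k ball by (auto simp: j_def d_def)
      \<comment> \<open>Once \<open>x j\<close> meets the conditions of the KL inequality, the
        distance \<open>dist0\<close> is at most the norm of the single member
        \<open>w\<close>.\<close>
      have "h a < h (x j)" using h rj by (simp add: r_def)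
      moreover have "h (x j) < h a + \<nu>"
        using j(1) h by (cases \<nu>) (auto simp: r_def)
      moreover have "x j \<in> V" using ball(2) \<rho>'(2) by (auto simp: j_def)
      ultimately have "1 \<le> ereal (deriv \<psi> (r j)) * dist0 (limiting_subdiff h (x j))"
        using KL'[of "x j"] h by (simp add: r_def)
      also have "\<dots> \<le> ereal (deriv \<psi> (r j)) * ereal (norm w)"
        using w(1) pos by (intro ereal_mult_left_mono) (auto simp: dist0_def intro: INF_lower)
      finally have "1 \<le> deriv \<psi> (r j) * norm w" by (simp add: one_ereal_def)
      also have "\<dots> \<le> deriv \<psi> (r j) * (b * d k + e k)"
        using w(2) pos by simp
      finally have 1: "1 \<le> deriv \<psi> (r j) * (b * d k + e k)" .
      have 2: "deriv \<psi> (r j) * (r j - r (Suc j)) \<le> \<psi> (r j) - \<psi> (r (Suc j))"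
        by (rule Xi_class_tangent[OF \<psi> rj j])
      have g0: "0 \<le> b * d k + e k" using e(2) \<open>b > 0\<close> by (simp add: d_def)
      \<comment> \<open>The gap \<open>r j - r (Suc j)\<close> is multiplied by a number that is at
        least 1, and the tangent inequality trades the factor \<open>deriv \<psi> (r j)\<close> for
        a difference of \<open>\<psi>\<close>.\<close>
      have "c * (d j)\<^sup>2 \<le> (r j - r (Suc j)) * 1" using desc[of j] by simp
      also have "\<dots> \<le> (r j - r (Suc j)) * (deriv \<psi> (r j) * (b * d k + e k))"
        using 1 j(3) by (intro mult_left_mono) auto
      also have "\<dots> = (deriv \<psi> (r j) * (r j - r (Suc j))) * (b * d k + e k)"
        by simp
      also have "\<dots> \<le> (\<psi> (r j) - \<psi> (r (Suc j))) * (b * d k + e k)"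
        using 2 g0 by (rule mult_right_mono)
      also have "\<dots> = c * ((b / c * (\<psi> (r j) - \<psi> (r (Suc j)))) * (d k + e k / b))"
        using descent(1) \<open>b > 0\<close> by (simp add: field_simps)
      finally have "(d j)\<^sup>2 \<le> (b / c * (\<psi> (r j) - \<psi> (r (Suc j)))) * (d k + e k / b)"
        using descent(1) by (simp only: mult_le_cancel_left_pos)
      moreover have "0 \<le> deriv \<psi> (r j) * (r j - r (Suc j))"
        using pos j(3) by simp
      ultimately show ?thesis using 2 by linarith
    qed
    moreover have "0 \<le> d k + e k / b" using e(2) \<open>b > 0\<close> by (simp add: d_def)
    ultimately have "2 * d j \<le> b / c * (\<psi> (r j) - \<psi> (r (Suc j))) + (d k + e k / b)"
      using \<open>b > 0\<close> descent(1) by (intro two_mul_le_add_of_power2_le_mult) auto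
    then have "d (Suc k) + E (Suc k) \<le> E k"
      using T_Suc[of k] by (simp add: E_def j_def right_diff_distrib)
    then show "dist (x (Suc k)) (x (Suc (Suc k))) + E (Suc k) \<le> E k" by (simp add: d_def)
  qed
qed

section \<open>The algorithm, its data and real-valued forms of the functions\<close>

locale ibpdca =
  fixes Q X N\<^sub>f N\<^sub>\<phi> N\<^sub>S :: "'a::euclidean_space set"
    and f P1 \<phi> :: "'a \<Rightarrow> ereal" and P2 :: "'a \<Rightarrow> real"
    and L \<mu> \<gamma>min \<gamma>max \<sigma> :: real
    and \<gamma> \<delta> :: "nat \<Rightarrow> real" and x \<xi> \<Delta> :: "nat \<Rightarrow> 'a" and K0 :: nat
  assumes Q: "closed Q" "closure (edom \<phi>) = Q"
    and proper: "proper \<phi>" "proper P1" "proper f"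
    and closed_fun: "closed_fun P1" "closed_fun f"
    and P2_cont: "continuous_on UNIV P2"
    and adaptable: "edom P1 \<inter> Q \<subseteq> X" "smooth_adaptable L f \<phi> X"
    and level: "level_bounded (objective Q P1 P2 f)"
    and N\<^sub>f: "open N\<^sub>f" "edom P1 \<inter> Q \<subseteq> N\<^sub>f" "eC1_on f N\<^sub>f" "lipschitz_on_bounded (egrad f) N\<^sub>f"
    and N\<^sub>\<phi>: "edom P1 \<inter> Q \<subseteq> N\<^sub>\<phi>" "\<mu> > 0" "strongly_convex_on \<mu> N\<^sub>\<phi> \<phi>"
      "ediff_on \<phi> N\<^sub>\<phi>" "lipschitz_on_bounded (egrad \<phi>) N\<^sub>\<phi>"
    and N\<^sub>S: "open N\<^sub>S" "stationary_points Q P1 P2 f \<subseteq> N\<^sub>S"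
      "eC1_on (\<lambda>y. ereal (P2 y)) N\<^sub>S" "locally_lipschitz_on (egrad (\<lambda>y. ereal (P2 y))) N\<^sub>S"
    and exact: "\<And>k. k \<ge> K0 \<Longrightarrow> \<delta> k = 0"
    and params: "L < \<gamma>min" "\<And>k. \<gamma>min \<le> \<gamma> k" "\<And>k. \<gamma> k \<le> \<gamma>max"
                "0 \<le> \<sigma>" "\<sigma> < (\<gamma>min - L) / \<gamma>min"
    and summ: "summable (\<lambda>k. norm (\<Delta> k))"
    and alg: "iBPDCA_SC1 f P1 P2 \<phi> \<gamma> \<sigma> x \<xi> \<Delta> \<delta>"
    and KL: "KL_function (objective Q P1 P2 f)"
begin

abbreviation "D \<equiv> edom P1 \<inter> Q"
abbreviation "F \<equiv> objective Q P1 P2 f"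
text \<open>The three real-valued versions carry information only where the extended values are
  finite: \<open>p1\<close> on \<open>D\<close>, \<open>fr\<close> on \<open>N\<^sub>f\<close>, and
  \<open>\<phi>r\<close> at the iterates.\<close>

definition "p1 y = real_of_ereal (P1 y)"
definition "fr y = real_of_ereal (f y)"
definition "\<phi>r y = real_of_ereal (\<phi> y)"
text \<open>The real value of \<open>F\<close> at \<open>x k\<close>, by \<open>F_D\<close> and
  \<open>x_D\<close>.\<close>

abbreviation "v k \<equiv> p1 (x k) - P2 (x k) + fr (x k)"
abbreviation "gP2 \<equiv> egrad (\<lambda>y. ereal (P2 y))"

text \<open>The inclusion for \<open>\<Delta> k\<close> solved for its subgradient of
  \<open>P1\<close>, so that no existential witness has to be carried along.\<close>

definition "p k = \<Delta> k - egrad f (x k) + \<xi> k - \<gamma> k *\<^sub>R (egrad \<phi> (x (Suc k)) - egrad \<phi> (x k))"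

text \<open>The decrease constant: the first factor is what remains of the Bregman distance after
  the losses from \<open>\<sigma>\<close> and \<open>L\<close>, and \<open>\<mu> / 2\<close>
  converts that distance into a squared norm.\<close>

definition "c = ((1 - \<sigma>) * \<gamma>min - L) * (\<mu> / 2)"

lemma P1_D: "y \<in> D \<Longrightarrow> P1 y = ereal (p1 y)"
  using proper(2) by (cases "P1 y") (auto simp: p1_def edom_def proper_def)

lemma f_N: "y \<in> N\<^sub>f \<Longrightarrow> f y = ereal (fr y)"
  using ediff_on_finite[of f N\<^sub>f y] N\<^sub>f(3) proper(3) by (simp add: eC1_on_def proper_def fr_def)

lemma F_D: "y \<in> D \<Longrightarrow> F y = ereal (p1 y - P2 y + fr y)"
  using P1_D[of y] f_N[of y] N\<^sub>f(2) by (auto simp: objective_def iota_def)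

lemma x_interior: "x k \<in> edom P1 \<inter> interior (edom \<phi>)"
  using alg by (cases k) (auto simp: iBPDCA_SC1_def)

lemma x_D: "x k \<in> D"
  using x_interior[of k] Q(2) interior_subset[of "edom \<phi>"] closure_subset[of "edom \<phi>"] by blast

lemma \<phi>_x: "\<phi> (x k) = ereal (\<phi>r (x k))"
  using ediff_on_finite[OF N\<^sub>\<phi>(4), of "x k"] x_D[of k] N\<^sub>\<phi>(1) proper(1) by (auto simp: proper_def \<phi>r_def)

lemma \<xi>_subgrad: "\<xi> k \<in> convex_subdiff (\<lambda>y. ereal (P2 y)) (x k)"
  using alg by (simp add: iBPDCA_SC1_def)

lemma p_subgrad: "p k \<in> eps_subdiff (\<delta> k) P1 (x (Suc k))"
proof -
  obtain q where q: "q \<in> eps_subdiff (\<delta> k) P1 (x (Suc k))"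
    "\<Delta> k = q + egrad f (x k) - \<xi> k + \<gamma> k *\<^sub>R (egrad \<phi> (x (Suc k)) - egrad \<phi> (x k))"
    using alg unfolding iBPDCA_SC1_def by blast
  then have "p k = q" by (simp add: p_def)
  with q(1) show ?thesis by simp
qed

lemma p_le: "ereal (p1 (x (Suc k)) + p k \<bullet> (y - x (Suc k)) - \<delta> k) \<le> P1 y"
  using p_subgrad[of k] P1_D[OF x_D[of "Suc k"]] by (simp add: eps_subdiff_def)

section \<open>Sufficient decrease and boundedness\<close>

lemma L_nonneg: "0 \<le> L"
  using adaptable(2) by (simp add: smooth_adaptable_def)

lemma c_pos: "c > 0"
proof -
  have "\<sigma> * \<gamma>min < \<gamma>min - L"
    using params L_nonneg by (simp add: pos_less_divide_eq)
  then have "0 < (1 - \<sigma>) * \<gamma>min - L" by (simp add: algebra_simps)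
  then show ?thesis using N\<^sub>\<phi>(2) by (simp add: c_def)
qed

text \<open>Adds three inequalities between \<open>x k\<close> and \<open>x (Suc k)\<close>: smooth
  adaptability for \<open>f\<close>, the subgradient inequality for \<open>P2\<close>, and the
  approximate one for \<open>P1\<close>. The gradients of \<open>f\<close> and the vectors
  \<open>\<xi> k\<close> cancel, leaving the inexactness terms and Bregman distances.\<close>

lemma descent: "v (Suc k) + c * (dist (x k) (x (Suc k)))\<^sup>2 \<le> v k"
proof -
  define d where "d = x (Suc k) - x k"
  define b where "b = \<phi>r (x (Suc k)) - \<phi>r (x k) - egrad \<phi> (x k) \<bullet> d"
  have noninf: "\<phi> z \<noteq> -\<infinity>" for z using proper(1) by (simp add: proper_def)
  have x_N: "x j \<in> N\<^sub>\<phi>" for j using x_D N\<^sub>\<phi>(1) by blast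
  note lower = bregman_lower_bound[OF N\<^sub>\<phi>(3,4) noninf x_N x_N, folded \<phi>r_def]
  have b_lower: "\<mu> / 2 * (dist (x k) (x (Suc k)))\<^sup>2 \<le> b"
    using lower[of "Suc k" k] by (simp add: b_def d_def dist_norm norm_minus_commute)
  moreover have "0 \<le> \<mu> / 2 * (dist (x k) (x (Suc k)))\<^sup>2" using N\<^sub>\<phi>(2) by simp
  ultimately have b0: "0 \<le> b" by linarith
  have breg: "bregman \<phi> (x (Suc k)) (x k) = ereal b"
    by (simp add: bregman_def \<phi>_x b_def d_def)
  \<comment> \<open>The inner product of the kernel gradient difference with \<open>d\<close> is the
    sum of the Bregman distances in both directions; the reverse one is nonnegative and is
    dropped.\<close>
  have "0 \<le> \<mu> / 2 * (norm (x k - x (Suc k)))\<^sup>2" using N\<^sub>\<phi>(2) by simp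
  also have "\<dots> \<le> \<phi>r (x k) - \<phi>r (x (Suc k)) - egrad \<phi> (x (Suc k)) \<bullet> (x k - x (Suc k))"
    by (rule lower)
  finally have "b \<le> (egrad \<phi> (x (Suc k)) - egrad \<phi> (x k)) \<bullet> d"
    by (simp add: b_def d_def algebra_simps)
  then have mono: "\<gamma> k * b \<le> \<gamma> k * ((egrad \<phi> (x (Suc k)) - egrad \<phi> (x k)) \<bullet> d)"
    using params(1) params(2)[of k] L_nonneg by (intro mult_left_mono) auto
  have "ereal ((norm (\<Delta> k))\<^sup>2 + \<bar>\<Delta> k \<bullet> d\<bar> + \<delta> k) \<le> ereal (\<sigma> * \<gamma> k) * ereal b"
    using alg unfolding iBPDCA_SC1_def d_def breg[symmetric] by blast
  then have "(norm (\<Delta> k))\<^sup>2 + \<bar>\<Delta> k \<bullet> d\<bar> + \<delta> k \<le> \<sigma> * \<gamma> k * b" by simp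
  \<comment> \<open>Only this signed consequence of the inexactness criterion enters the decrease;
    here it absorbs both \<open>\<Delta> k\<close> and \<open>\<delta> k\<close>.\<close>
  then have crit: "\<Delta> k \<bullet> d + \<delta> k \<le> \<sigma> * \<gamma> k * b"
    using zero_le_power2[of "norm (\<Delta> k)"] by linarith
  have "\<bar>f (x (Suc k)) - f (x k) - ereal (egrad f (x k) \<bullet> d)\<bar> \<le> ereal L * ereal b"
    using adaptable x_D x_interior[of k] x_interior[of "Suc k"] interior_subset[of "edom \<phi>"]
    unfolding smooth_adaptable_def breg[symmetric] d_def by blast
  moreover have "x j \<in> N\<^sub>f" for j using x_D N\<^sub>f(2) by blast
  ultimately have fle: "fr (x (Suc k)) \<le> fr (x k) + egrad f (x k) \<bullet> d + L * b"
    by (simp add: f_N)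
  have P2le: "P2 (x k) + \<xi> k \<bullet> d \<le> P2 (x (Suc k))"
    using \<xi>_subgrad[of k] unfolding convex_subdiff_real_iff d_def by blast
  have "p1 (x (Suc k)) + p k \<bullet> (x k - x (Suc k)) - \<delta> k \<le> p1 (x k)"
    using p_le[of k "x k"] P1_D[OF x_D[of k]] by simp
  then have P1le: "p1 (x (Suc k)) \<le> p1 (x k) + p k \<bullet> d + \<delta> k"
    by (simp add: d_def inner_diff_right)
  have "p k \<bullet> d = \<Delta> k \<bullet> d - egrad f (x k) \<bullet> d + \<xi> k \<bullet> d
      - \<gamma> k * ((egrad \<phi> (x (Suc k)) - egrad \<phi> (x k)) \<bullet> d)"
    by (simp add: p_def inner_diff_left inner_add_left)
  then have "v (Suc k) \<le> v k + \<sigma> * \<gamma> k * b - \<gamma> k * b + L * b"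
    using fle P2le P1le crit mono by linarith
  also have "\<dots> = v k - ((1 - \<sigma>) * \<gamma> k - L) * b" by (simp add: algebra_simps)
  also have "\<dots> \<le> v k - ((1 - \<sigma>) * \<gamma>min - L) * (\<mu> / 2 * (dist (x k) (x (Suc k)))\<^sup>2)"
  proof -
    have "\<sigma> * \<gamma>min < \<gamma>min - L"
      using params L_nonneg by (simp add: pos_less_divide_eq)
    then have "\<sigma> * \<gamma>min < 1 * \<gamma>min" using L_nonneg by simp
    then have "\<sigma> < 1" using params(1) L_nonneg by (simp add: mult_less_cancel_right)
    then have le: "(1 - \<sigma>) * \<gamma>min - L \<le> (1 - \<sigma>) * \<gamma> k - L"
      using params(2)[of k] by simp
    have "0 \<le> (1 - \<sigma>) * \<gamma>min - L"
      using \<open>\<sigma> * \<gamma>min < \<gamma>min - L\<close> by (simp add: algebra_simps)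
    then have "((1 - \<sigma>) * \<gamma>min - L) * (\<mu> / 2 * (dist (x k) (x (Suc k)))\<^sup>2) \<le> ((1 - \<sigma>) * \<gamma> k - L) * b"
      using b_lower le b0 N\<^sub>\<phi>(2) by (intro mult_mono) auto
    then show ?thesis by simp
  qed
  also have "\<dots> = v k - c * (dist (x k) (x (Suc k)))\<^sup>2"
    by (simp only: c_def mult.assoc)
  finally show ?thesis by linarith
qed

lemma v_decseq: "decseq v"
proof (rule decseq_SucI)
  fix k
  have "0 \<le> c * (dist (x k) (x (Suc k)))\<^sup>2" using c_pos by simp
  then show "v (Suc k) \<le> v k" using descent[of k] by linarith
qed

lemma bounded_x: "bounded (range x)"
proof -
  have "F (x k) \<le> ereal (v 0)" for k
    using F_D[OF x_D[of k]] decseqD[OF v_decseq, of 0 k] by simp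
  then have "range x \<subseteq> {y. F y \<le> ereal (v 0)}" by blast
  then show ?thesis using level unfolding level_bounded_def by (meson bounded_subset)
qed

section \<open>Cluster points: function values and stationarity\<close>

lemma P2_lim: "z \<longlonglongrightarrow> a \<Longrightarrow> (\<lambda>n. P2 (z n)) \<longlonglongrightarrow> P2 a"
  using P2_cont continuous_on_tendsto_compose[of UNIV P2 z a sequentially] by simp

text \<open>\<open>Q\<close> is closed, but the domain of \<open>P1\<close> need not be. Since the
  values \<open>v\<close> stay below \<open>v 0\<close>, lower semicontinuity of \<open>f\<close>
  and continuity of \<open>P2\<close> bound \<open>P1\<close> above along the sequence, and the
  closed epigraph passes the bound to \<open>a\<close>.\<close>

lemma limit_in_D:
  assumes a: "(\<lambda>n. x (s n)) \<longlonglongrightarrow> a"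
  shows "a \<in> D"
proof -
  have "a \<in> Q" using closed_sequentially[OF Q(1) _ a] x_D by blast
  have "f a \<noteq> -\<infinity>" using proper(3) by (simp add: proper_def)
  \<comment> \<open>At this stage \<open>f a\<close> could still be \<open>\<infinity>\<close>, so a
    real lower level \<open>t\<close> is used in place of the value.\<close>
  then obtain t where t: "ereal t < f a"
    by (metis ereal_dense2 ereal_MInfty_lessI)
  define u where "u = v 0 + (P2 a + 1) - t"
  have "\<forall>\<^sub>F n in sequentially. ereal t < f (x (s n))"
    using closed_fun(2) a t by (rule closed_fun_lsc)
  moreover have "\<forall>\<^sub>F n in sequentially. P2 (x (s n)) < P2 a + 1"
    using P2_lim[OF a] by (rule order_tendstoD) simp
  ultimately have ev: "\<forall>\<^sub>F n in sequentially. P1 (x (s n)) \<le> ereal u"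
  proof eventually_elim
    case (elim n)
    have "x (s n) \<in> N\<^sub>f" using x_D[of "s n"] N\<^sub>f(2) by blast
    then have "t < fr (x (s n))" using elim(1) f_N[of "x (s n)"] by simp
    moreover have "v (s n) \<le> v 0" using decseqD[OF v_decseq, of 0 "s n"] by simp
    ultimately have "p1 (x (s n)) \<le> u" using elim(2) by (simp add: u_def)
    then show ?case using P1_D[OF x_D[of "s n"]] by simp
  qed
  have "P1 a \<le> ereal u"
  proof (rule ccontr)
    assume "\<not> P1 a \<le> ereal u"
    then have "\<forall>\<^sub>F n in sequentially. ereal u < P1 (x (s n))"
      using closed_fun_lsc[OF closed_fun(1) a] by simp
    with ev have "\<forall>\<^sub>F n in sequentially. False" by eventually_elim simp
    then show False by simp
  qed
  then have "P1 a < \<infinity>" by (rule order_le_less_trans) simp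
  with \<open>a \<in> Q\<close> show ?thesis by (simp add: edom_def)
qed

lemma fr_lim:
  assumes "a \<in> D" "z \<longlonglongrightarrow> a"
  shows "(\<lambda>n. fr (z n)) \<longlonglongrightarrow> fr a"
proof -
  have "fr differentiable (at a)"
    using assms(1) N\<^sub>f(2,3) by (auto simp: eC1_on_def ediff_on_def fr_def[abs_def])
  then have "isCont fr a" by (rule differentiable_imp_continuous_within)
  then show ?thesis using assms(2) by (rule isCont_tendsto_compose)
qed

lemma P1_lower:
  assumes "a \<in> D" "z \<longlonglongrightarrow> a" "\<And>n. z n \<in> D" "\<epsilon> > 0"
  shows "\<forall>\<^sub>F n in sequentially. p1 a - \<epsilon> < p1 (z n)"
proof -
  have "\<forall>\<^sub>F n in sequentially. ereal (p1 a - \<epsilon>) < P1 (z n)"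
    using assms P1_D[of a] by (intro closed_fun_lsc[OF closed_fun(1)]) auto
  then show ?thesis
    by eventually_elim (metis P1_D assms(3) less_ereal.simps(1))
qed

lemma cluster_exists: "\<exists>s a. strict_mono s \<and> (x \<circ> s) \<longlonglongrightarrow> a"
  using bounded_imp_convergent_subsequence[OF bounded_x] by blast

text \<open>A lower bound along one convergent subsequence, with slack 1 in each term, extends to
  the whole sequence by monotonicity.\<close>

lemma v_convergent: "\<exists>\<zeta>. v \<longlonglongrightarrow> \<zeta>"
proof -
  obtain s a where s: "strict_mono s" and "(x \<circ> s) \<longlonglongrightarrow> a" using cluster_exists by blast
  then have a: "(\<lambda>n. x (s n)) \<longlonglongrightarrow> a" by (simp add: o_def)
  note aD = limit_in_D[OF a]
  define m where "m = (p1 a - 1) - (P2 a + 1) + (fr a - 1)"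
  have "\<forall>\<^sub>F n in sequentially. p1 a - 1 < p1 (x (s n))"
    using x_D by (intro P1_lower[OF aD a]) auto
  moreover have "\<forall>\<^sub>F n in sequentially. P2 (x (s n)) < P2 a + 1"
    using P2_lim[OF a] by (rule order_tendstoD) simp
  moreover have "\<forall>\<^sub>F n in sequentially. fr a - 1 < fr (x (s n))"
    using fr_lim[OF aD a] by (rule order_tendstoD) simp
  ultimately have ev: "\<forall>\<^sub>F n in sequentially. m \<le> v (s n)"
    by eventually_elim (simp add: m_def)
  have "m \<le> v k" for k
  proof -
    have "\<forall>\<^sub>F n in sequentially. k \<le> n" by (rule eventually_ge_at_top)
    with ev have "\<forall>\<^sub>F n in sequentially. m \<le> v (s n) \<and> k \<le> n" by (rule eventually_conj)
    then obtain n where n: "m \<le> v (s n)" "k \<le> n"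
      using eventually_happens by fastforce
    then have "k \<le> s n" using seq_suble[OF s, of n] by linarith
    then show ?thesis using n(1) decseqD[OF v_decseq, of k "s n"] by linarith
  qed
  then show ?thesis using decseq_convergent[OF v_decseq] by blast
qed

lemma dist_lim: "(\<lambda>k. dist (x k) (x (Suc k))) \<longlonglongrightarrow> 0"
proof -
  obtain \<zeta> where v: "v \<longlonglongrightarrow> \<zeta>" using v_convergent by blast
  show ?thesis using null_steps_of_descent[OF v c_pos descent] .
qed

lemma Suc_lim:
  assumes "strict_mono s" "(\<lambda>n. x (s n)) \<longlonglongrightarrow> a"
  shows "(\<lambda>n. x (Suc (s n))) \<longlonglongrightarrow> a"
proof -
  have "(\<lambda>n. dist (x (s n)) (x (Suc (s n)))) \<longlonglongrightarrow> 0"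
    using LIMSEQ_subseq_LIMSEQ[OF dist_lim assms(1)] by (simp add: o_def)
  then have "(\<lambda>n. x (s n) - x (Suc (s n))) \<longlonglongrightarrow> 0"
    by (simp add: dist_norm tendsto_norm_zero_iff)
  from tendsto_diff[OF assms(2) this] show ?thesis by simp
qed

lemma lipschitz_range:
  assumes "lipschitz_on_bounded g N" "D \<subseteq> N"
  obtains K where "K-lipschitz_on (range x) g"
proof -
  have "range x \<subseteq> N" using x_D assms(2) by blast
  then show thesis using assms(1) bounded_x that unfolding lipschitz_on_bounded_def by blast
qed

lemma \<gamma>_bounds: "0 \<le> \<gamma> k" "\<bar>\<gamma> k\<bar> \<le> \<gamma>max"
  using params(1) params(2)[of k] params(3)[of k] L_nonneg by auto

lemma bounded_\<xi>: "bounded (range \<xi>)"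
  using convex_subdiff_bounded[OF P2_cont bounded_x]
  by (rule bounded_subset) (use \<xi>_subgrad in blast)

text \<open>\<open>\<Delta>\<close> vanishes by summability, and the kernel term by the Lipschitz
  bound, bounded \<open>\<gamma>\<close> and vanishing steps. Subtracting \<open>\<xi>\<close>
  matters: it is bounded but need not converge along \<open>s\<close>.\<close>

lemma gradient_terms_lim:
  assumes s: "strict_mono s" and a: "(\<lambda>n. x (s n)) \<longlonglongrightarrow> a"
  shows "(\<lambda>n. p (s n) - \<xi> (s n)) \<longlonglongrightarrow> - egrad f a"
proof -
  obtain K where K: "K-lipschitz_on (range x) (egrad \<phi>)"
    using lipschitz_range[OF N\<^sub>\<phi>(5,1)] by blast
  have "a \<in> N\<^sub>f" using limit_in_D[OF a] N\<^sub>f(2) by blast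
  then have "isCont (egrad f) a"
    using N\<^sub>f(1,3) by (simp add: eC1_on_def continuous_on_eq_continuous_at)
  then have gf: "(\<lambda>n. egrad f (x (s n))) \<longlonglongrightarrow> egrad f a"
    using a by (rule isCont_tendsto_compose)
  have "\<Delta> \<longlonglongrightarrow> 0"
    using summable_LIMSEQ_zero[OF summ] by (simp add: tendsto_norm_zero_iff)
  then have \<Delta>: "(\<lambda>n. \<Delta> (s n)) \<longlonglongrightarrow> 0"
    using LIMSEQ_subseq_LIMSEQ[OF _ s] by (simp add: o_def)
  have "(\<lambda>k. \<gamma>max * (K * dist (x k) (x (Suc k)))) \<longlonglongrightarrow> \<gamma>max * (K * 0)"
    by (intro tendsto_intros dist_lim)
  then have null: "(\<lambda>k. \<gamma>max * (K * dist (x k) (x (Suc k)))) \<longlonglongrightarrow> 0" by simp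
  have bound: "norm (\<gamma> k *\<^sub>R (egrad \<phi> (x (Suc k)) - egrad \<phi> (x k)))
      \<le> \<gamma>max * (K * dist (x k) (x (Suc k)))" for k
  proof -
    have "norm (egrad \<phi> (x (Suc k)) - egrad \<phi> (x k)) \<le> K * dist (x k) (x (Suc k))"
      using lipschitz_onD[OF K, of "x (Suc k)" "x k"] by (simp add: dist_norm dist_commute norm_minus_commute)
    then show ?thesis using \<gamma>_bounds[of k] by (simp add: mult_mono)
  qed
  have "(\<lambda>k. \<gamma> k *\<^sub>R (egrad \<phi> (x (Suc k)) - egrad \<phi> (x k))) \<longlonglongrightarrow> 0"
    by (rule Lim_null_comparison[OF always_eventually null]) (use bound in blast)
  then have "(\<lambda>n. \<gamma> (s n) *\<^sub>R (egrad \<phi> (x (Suc (s n))) - egrad \<phi> (x (s n)))) \<longlonglongrightarrow> 0"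
    using LIMSEQ_subseq_LIMSEQ[OF _ s] by (simp add: o_def)
  from tendsto_diff[OF tendsto_diff[OF \<Delta> gf] this] show ?thesis
    by (simp add: p_def algebra_simps)
qed

text \<open>Lower semicontinuity gives only one half. The upper half tests the subgradient
  inequality at \<open>x (Suc (s n))\<close> against \<open>a\<close>, with \<open>p\<close> bounded
  and \<open>\<delta>\<close> equal to 0 from \<open>K0\<close> on; hence the shifted index.\<close>

lemma P1_lim:
  assumes s: "strict_mono s" and a: "(\<lambda>n. x (s n)) \<longlonglongrightarrow> a"
  shows "(\<lambda>n. p1 (x (Suc (s n)))) \<longlonglongrightarrow> p1 a"
proof -
  have aD: "a \<in> D" by (rule limit_in_D[OF a])
  have "bounded (range (\<lambda>n. p (s n) - \<xi> (s n)))"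
    using gradient_terms_lim[OF s a] by (intro convergent_imp_bounded)
  moreover have "bounded (range (\<lambda>n. \<xi> (s n)))"
    using bounded_\<xi> by (rule bounded_subset) auto
  ultimately have "bounded (range (\<lambda>n. (p (s n) - \<xi> (s n)) + \<xi> (s n)))"
    by (rule bounded_plus_comp)
  then obtain M where M: "\<And>n. norm (p (s n)) \<le> M" by (auto simp: bounded_iff)
  have "(\<lambda>n. M * norm (x (Suc (s n)) - a)) \<longlonglongrightarrow> M * 0"
    by (intro tendsto_mult tendsto_const tendsto_norm_zero LIM_zero Suc_lim[OF s a])
  then have u: "(\<lambda>n. p1 a + M * norm (x (Suc (s n)) - a)) \<longlonglongrightarrow> p1 a + M * 0"
    by (rule tendsto_add[OF tendsto_const])
  have K: "\<forall>\<^sub>F n in sequentially. p1 (x (Suc (s n))) \<le> p1 a + M * norm (x (Suc (s n)) - a)"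
    using eventually_ge_at_top[of K0]
  proof eventually_elim
    case (elim n)
    then have "\<delta> (s n) = 0" using seq_suble[OF s, of n] exact by auto
    then have "p1 (x (Suc (s n))) + p (s n) \<bullet> (a - x (Suc (s n))) \<le> p1 a"
      using p_le[of "s n" a] P1_D[OF aD] by simp
    moreover have "p (s n) \<bullet> (x (Suc (s n)) - a) \<le> norm (p (s n)) * norm (x (Suc (s n)) - a)"
      by (rule norm_cauchy_schwarz)
    moreover have "\<dots> \<le> M * norm (x (Suc (s n)) - a)" using M by (rule mult_right_mono) simp
    ultimately show ?case by (simp add: inner_diff_right)
  qed
  show ?thesis
  proof (rule order_tendstoI)
    fix l assume "l < p1 a"
    then have "\<forall>\<^sub>F n in sequentially. p1 a - (p1 a - l) < p1 (x (Suc (s n)))"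
      using Suc_lim[OF s a] x_D aD by (intro P1_lower) auto
    then show "\<forall>\<^sub>F n in sequentially. l < p1 (x (Suc (s n)))" by simp
  next
    fix l assume "p1 a < l"
    then have "\<forall>\<^sub>F n in sequentially. p1 a + M * norm (x (Suc (s n)) - a) < l"
      by (intro order_tendstoD(2)[OF u]) simp
    with K show "\<forall>\<^sub>F n in sequentially. p1 (x (Suc (s n))) < l" by eventually_elim simp
  qed
qed

lemma cluster_value:
  assumes s: "strict_mono s" and a: "(\<lambda>n. x (s n)) \<longlonglongrightarrow> a" and v: "v \<longlonglongrightarrow> \<zeta>"
  shows "F a = ereal \<zeta>"
proof -
  have aD: "a \<in> D" by (rule limit_in_D[OF a])
  have "(\<lambda>n. v (Suc (s n))) \<longlonglongrightarrow> p1 a - P2 a + fr a"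
    using Suc_lim[OF s a] by (intro tendsto_intros P1_lim[OF s a] P2_lim fr_lim[OF aD])
  moreover have "(\<lambda>n. v (Suc (s n))) \<longlonglongrightarrow> \<zeta>"
    using LIMSEQ_subseq_LIMSEQ[OF LIMSEQ_Suc[OF v] s] by (simp add: o_def)
  ultimately have "\<zeta> = p1 a - P2 a + fr a" by (rule LIMSEQ_unique[rotated])
  then show ?thesis using F_D[OF aD] by simp
qed

text \<open>Along a further subsequence the bounded \<open>\<xi>\<close> converge to some
  \<open>w\<close>, so the \<open>p\<close> converge as well, and both subgradient inequalities pass
  to the limit.\<close>

lemma cluster_critical:
  assumes s: "strict_mono s" and a: "(\<lambda>n. x (s n)) \<longlonglongrightarrow> a"
  obtains q w where "q \<in> convex_subdiff P1 a" "w \<in> convex_subdiff (\<lambda>y. ereal (P2 y)) a"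
    "q - w + egrad f a = 0"
proof -
  have aD: "a \<in> D" by (rule limit_in_D[OF a])
  have "bounded (range (\<xi> \<circ> s))" using bounded_\<xi> by (rule bounded_subset) auto
  then obtain w t where t: "strict_mono t" and w: "(\<xi> \<circ> s \<circ> t) \<longlonglongrightarrow> w"
    using bounded_imp_convergent_subsequence by blast
  define j where "j n = s (t n)" for n
  have j: "strict_mono j" using strict_mono_o[OF s t] by (simp add: j_def[abs_def] o_def)
  have xj: "(\<lambda>n. x (j n)) \<longlonglongrightarrow> a"
    using LIMSEQ_subseq_LIMSEQ[OF a t] by (simp add: j_def o_def)
  have \<xi>j: "(\<lambda>n. \<xi> (j n)) \<longlonglongrightarrow> w" using w by (simp add: j_def o_def)
  from tendsto_add[OF gradient_terms_lim[OF j xj] \<xi>j]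
  have pj: "(\<lambda>n. p (j n)) \<longlonglongrightarrow> - egrad f a + w" by simp
  have "- egrad f a + w \<in> convex_subdiff P1 a"
    unfolding eps_subdiff_def
  proof (intro CollectI conjI allI)
    show "a \<in> edom P1" using aD by simp
    fix y
    have "(\<lambda>n. ereal (p1 (x (Suc (j n))) + p (j n) \<bullet> (y - x (Suc (j n))))) \<longlonglongrightarrow>
        ereal (p1 a + (- egrad f a + w) \<bullet> (y - a))"
      by (intro tendsto_intros P1_lim[OF j xj] pj Suc_lim[OF j xj])
    moreover have "\<forall>\<^sub>F n in sequentially.
        ereal (p1 (x (Suc (j n))) + p (j n) \<bullet> (y - x (Suc (j n)))) \<le> P1 y"
      using eventually_ge_at_top[of K0]
    proof eventually_elim
      case (elim n)
      then have "\<delta> (j n) = 0" using seq_suble[OF j, of n] exact by auto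
      then show ?case using p_le[of "j n" y] by simp
    qed
    ultimately have "ereal (p1 a + (- egrad f a + w) \<bullet> (y - a)) \<le> P1 y"
      by (rule tendsto_upperbound) simp
    then show "P1 a + ereal ((- egrad f a + w) \<bullet> (y - a)) - ereal 0 \<le> P1 y"
      using P1_D[OF aD] by simp
  qed
  moreover have "w \<in> convex_subdiff (\<lambda>y. ereal (P2 y)) a"
    unfolding convex_subdiff_real_iff
  proof
    fix y
    have "(\<lambda>n. P2 (x (j n)) + \<xi> (j n) \<bullet> (y - x (j n))) \<longlonglongrightarrow> P2 a + w \<bullet> (y - a)"
      by (intro tendsto_intros P2_lim xj \<xi>j)
    then show "P2 a + w \<bullet> (y - a) \<le> P2 y"
      using \<xi>_subgrad unfolding convex_subdiff_real_iff by (intro LIMSEQ_le_const2) auto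
  qed
  ultimately show thesis using that by force
qed

lemma convex_subdiff_iota_plus:
  assumes "a \<in> Q" "q \<in> convex_subdiff P1 a"
  shows "q \<in> convex_subdiff (\<lambda>y. iota Q y + P1 y) a"
proof -
  have "P1 y \<le> iota Q y + P1 y" for y
    using add_right_mono[of 0 "iota Q y" "P1 y"] by (simp add: iota_def)
  then show ?thesis
    using assms by (auto simp: eps_subdiff_def edom_def iota_def intro: order_trans)
qed

text \<open>Stationarity comes first: it places \<open>a\<close> in \<open>N\<^sub>S\<close>, where
  \<open>P2\<close> is differentiable and \<open>w\<close> must be its gradient. The nonempty
  limiting subdifferential is what lets \<open>KL_function\<close> be applied at
  \<open>a\<close>.\<close>

lemma cluster_l_stationary:
  assumes s: "strict_mono s" and a: "(\<lambda>n. x (s n)) \<longlonglongrightarrow> a"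
  shows "a \<in> N\<^sub>S" "l_stationary Q P1 P2 f a" "limiting_subdiff F a \<noteq> {}"
proof -
  have aD: "a \<in> D" by (rule limit_in_D[OF a])
  obtain q w where q: "q \<in> convex_subdiff P1 a"
    and w: "w \<in> convex_subdiff (\<lambda>y. ereal (P2 y)) a" and eq: "q - w + egrad f a = 0"
    by (rule cluster_critical[OF s a])
  have q': "q \<in> convex_subdiff (\<lambda>y. iota Q y + P1 y) a"
    using aD q by (intro convex_subdiff_iota_plus) auto
  then have "a \<in> stationary_points Q P1 P2 f"
    unfolding stationary_points_def using w eq by force
  then show aN: "a \<in> N\<^sub>S" using N\<^sub>S(2) by blast
  then have diff: "P2 differentiable (at a)"
    using N\<^sub>S(3) by (simp add: eC1_on_def ediff_on_def)
  have w': "w = gP2 a" by (rule convex_subdiff_eq_egrad[OF w diff])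
  show "l_stationary Q P1 P2 f a"
    unfolding l_stationary_def using N\<^sub>S(1,3) aN q' eq w' by force
  have "a \<in> N\<^sub>f" using aD N\<^sub>f(2) by blast
  then have "q - gP2 a + egrad f a \<in> regular_subdiff F a"
    using aD N\<^sub>f(1,3) proper(3) P1_D[OF aD]
    by (intro regular_subdiff_objective[OF q _ _ _ _ _ _ diff]) (auto simp: eC1_on_def proper_def)
  then show "limiting_subdiff F a \<noteq> {}" using regular_subset_limiting by blast
qed

section \<open>Subgradients at the iterates and convergence\<close>

text \<open>Near \<open>a\<close> the vector \<open>\<xi> k\<close> is the gradient of
  \<open>P2\<close>, and \<open>\<delta> k = 0\<close> makes \<open>p k\<close> an exact
  subgradient. Moving the gradients of \<open>f\<close> and \<open>P2\<close> from
  \<open>x k\<close> to \<open>x (Suc k)\<close> costs Lipschitz terms.\<close>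

lemma subgradient_bound:
  assumes a: "a \<in> N\<^sub>S"
  obtains \<rho> b where "\<rho> > 0" "b > 0"
    "\<And>k. k \<ge> K0 \<Longrightarrow> x k \<in> ball a \<rho> \<Longrightarrow> x (Suc k) \<in> ball a \<rho> \<Longrightarrow>
      \<exists>w\<in>limiting_subdiff F (x (Suc k)). norm w \<le> b * dist (x k) (x (Suc k)) + norm (\<Delta> k)"
proof -
  obtain K\<^sub>\<phi> where K\<^sub>\<phi>: "K\<^sub>\<phi>-lipschitz_on (range x) (egrad \<phi>)"
    using lipschitz_range[OF N\<^sub>\<phi>(5,1)] by blast
  obtain K\<^sub>f where K\<^sub>f: "K\<^sub>f-lipschitz_on (range x) (egrad f)"
    using lipschitz_range[OF N\<^sub>f(4,2)] by blast
  obtain u K where u: "u > 0" "K-lipschitz_on (ball a u \<inter> N\<^sub>S) gP2"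
    using N\<^sub>S(4) a unfolding locally_lipschitz_on_def by blast
  obtain \<rho> where \<rho>: "\<rho> > 0" "ball a \<rho> \<subseteq> ball a u \<inter> N\<^sub>S"
    using openE[of "ball a u \<inter> N\<^sub>S" a] N\<^sub>S(1) a u(1) by (metis IntI centre_in_ball open_Int open_ball)
  \<comment> \<open>One Lipschitz constant for each gradient difference below; the summand 1 makes
    \<open>b\<close> strictly positive.\<close>
  define b where "b = K\<^sub>f + K + \<gamma>max * K\<^sub>\<phi> + 1"
  have "0 \<le> \<gamma>max" using \<gamma>_bounds[of 0] by linarith
  then have "b > 0"
    using lipschitz_on_nonneg[OF K\<^sub>\<phi>] lipschitz_on_nonneg[OF K\<^sub>f] lipschitz_on_nonneg[OF u(2)]
    by (simp add: b_def add_nonneg_pos)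
  show thesis
  proof (rule that[OF \<rho>(1) \<open>b > 0\<close>])
    fix k assume k: "k \<ge> K0" and ball: "x k \<in> ball a \<rho>" "x (Suc k) \<in> ball a \<rho>"
    define d where "d = dist (x k) (x (Suc k))"
    have N: "x k \<in> ball a u \<inter> N\<^sub>S" "x (Suc k) \<in> ball a u \<inter> N\<^sub>S" using ball \<rho>(2) by blast+
    then have diff: "P2 differentiable (at (x k))" "P2 differentiable (at (x (Suc k)))"
      using N\<^sub>S(3) by (auto simp: eC1_on_def ediff_on_def)
    have \<xi>: "\<xi> k = gP2 (x k)" by (rule convex_subdiff_eq_egrad[OF \<xi>_subgrad diff(1)])
    have pk: "p k \<in> convex_subdiff P1 (x (Suc k))"
      using p_subgrad[of k] exact[OF k] by simp
    define w where "w = p k - gP2 (x (Suc k)) + egrad f (x (Suc k))"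
    have "x (Suc k) \<in> N\<^sub>f" "x (Suc k) \<in> Q" using x_D[of "Suc k"] N\<^sub>f(2) by auto
    then have "w \<in> regular_subdiff F (x (Suc k))"
      unfolding w_def using N\<^sub>f(1,3) proper(3) P1_D[OF x_D[of "Suc k"]]
      by (intro regular_subdiff_objective[OF pk _ _ _ _ _ _ diff(2)]) (auto simp: eC1_on_def proper_def)
    moreover have "norm w \<le> b * d + norm (\<Delta> k)"
    proof -
      have 1: "norm (egrad f (x (Suc k)) - egrad f (x k)) \<le> K\<^sub>f * d"
        using lipschitz_onD[OF K\<^sub>f, of "x (Suc k)" "x k"] by (simp add: d_def dist_norm norm_minus_commute)
      have 2: "norm (gP2 (x k) - gP2 (x (Suc k))) \<le> K * d"
        using lipschitz_onD[OF u(2) N] by (simp add: d_def dist_norm)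
      have "norm (egrad \<phi> (x (Suc k)) - egrad \<phi> (x k)) \<le> K\<^sub>\<phi> * d"
        using lipschitz_onD[OF K\<^sub>\<phi>, of "x (Suc k)" "x k"] by (simp add: d_def dist_norm norm_minus_commute)
      then have 3: "norm (\<gamma> k *\<^sub>R (egrad \<phi> (x (Suc k)) - egrad \<phi> (x k))) \<le> \<gamma>max * (K\<^sub>\<phi> * d)"
        using \<gamma>_bounds[of k] by (simp add: mult_mono)
      have w: "w = \<Delta> k + (egrad f (x (Suc k)) - egrad f (x k)) + (gP2 (x k) - gP2 (x (Suc k)))
          - \<gamma> k *\<^sub>R (egrad \<phi> (x (Suc k)) - egrad \<phi> (x k))"
        by (simp add: w_def p_def \<xi>)
      have "norm w \<le> norm (\<Delta> k) + norm (egrad f (x (Suc k)) - egrad f (x k))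
          + norm (gP2 (x k) - gP2 (x (Suc k)))
          + norm (\<gamma> k *\<^sub>R (egrad \<phi> (x (Suc k)) - egrad \<phi> (x k)))"
        unfolding w by (intro norm_triangle_le_diff norm_triangle_le add_mono order_refl)
      also have "\<dots> \<le> norm (\<Delta> k) + K\<^sub>f * d + K * d + \<gamma>max * (K\<^sub>\<phi> * d)"
        using 1 2 3 by (intro add_mono order_refl)
      also have "\<dots> \<le> b * d + norm (\<Delta> k)"
        by (simp add: b_def d_def algebra_simps)
      finally show ?thesis .
    qed
    ultimately show "\<exists>w\<in>limiting_subdiff F (x (Suc k)). norm w \<le> b * dist (x k) (x (Suc k)) + norm (\<Delta> k)"
      using regular_subset_limiting unfolding d_def by blast
  qed
qed

theorem converges_to_l_stationary: "\<exists>a. x \<longlonglongrightarrow> a \<and> l_stationary Q P1 P2 f a"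
proof -
  obtain s a where s: "strict_mono s" and xs: "(x \<circ> s) \<longlonglongrightarrow> a" using cluster_exists by blast
  then have a: "(\<lambda>n. x (s n)) \<longlonglongrightarrow> a" by (simp add: o_def)
  note cluster = cluster_l_stationary[OF s a]
  obtain \<zeta> where v: "v \<longlonglongrightarrow> \<zeta>" using v_convergent by blast
  obtain \<rho> b where pos: "\<rho> > 0" "b > 0" and bound:
    "\<And>k. k \<ge> K0 \<Longrightarrow> x k \<in> ball a \<rho> \<Longrightarrow> x (Suc k) \<in> ball a \<rho> \<Longrightarrow>
      \<exists>w\<in>limiting_subdiff F (x (Suc k)). norm w \<le> b * dist (x k) (x (Suc k)) + norm (\<Delta> k)"
    using subgradient_bound[OF cluster(1)] by blast
  have "KL_property F a" using KL cluster(3) by (simp add: KL_function_def)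
  then have "x \<longlonglongrightarrow> a"
    by (rule KL_descent_converges[OF cluster_value[OF s a v] F_D[OF x_D] s xs v c_pos descent
          _ summ norm_ge_zero pos bound])
  with cluster(2) show ?thesis by blast
qed

end

theorem theorem4p2:
  fixes Q X N\<^sub>f N\<^sub>\<phi> N\<^sub>S :: "'a::euclidean_space set"
    and f P1 \<phi> :: "'a \<Rightarrow> ereal" and P2 :: "'a \<Rightarrow> real"
    and L \<mu> \<gamma>min \<gamma>max \<sigma> :: real
    and \<gamma> \<delta> :: "nat \<Rightarrow> real" and x \<xi> \<Delta> :: "nat \<Rightarrow> 'a" and K0 :: nat
  assumes Q: "closed Q" "convex Q" "interior Q \<noteq> {}"
    and kernel: "proper \<phi>" "closed_fun \<phi>"
    and A1: "essentially_smooth \<phi>" "strictly_convex_on (edom \<phi>) \<phi>" "closure (edom \<phi>) = Q"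
    and A2: "proper P1" "closed_fun P1" "convex_fun P1" "edom P1 \<inter> interior Q \<noteq> {}"
            "continuous_on UNIV P2" "convex_on UNIV P2"
    and A3: "proper f" "closed_fun f" "edom \<phi> \<subseteq> edom f" "eC1_on f (interior (edom f))"
            "edom P1 \<inter> Q \<subseteq> X" "smooth_adaptable L f \<phi> X"
    and A4: "level_bounded (objective Q P1 P2 f)"
    and A5: "\<And>k. argmin_set (subproblem f P1 \<phi> (x k) (\<xi> k) (\<gamma> k)) \<noteq> {} \<and>
                  argmin_set (subproblem f P1 \<phi> (x k) (\<xi> k) (\<gamma> k)) \<subseteq> interior (edom \<phi>)"
    and B: "open N\<^sub>f" "edom P1 \<inter> Q \<subseteq> N\<^sub>f" "eC1_on f N\<^sub>f"
    and C: "open N\<^sub>\<phi>" "edom P1 \<inter> Q \<subseteq> N\<^sub>\<phi>" "N\<^sub>\<phi> \<subseteq> interior (edom \<phi>)"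
    and C1: "\<mu> > 0" "strongly_convex_on \<mu> N\<^sub>\<phi> \<phi>"
    and C2: "ediff_on \<phi> N\<^sub>\<phi>" "lipschitz_on_bounded (egrad \<phi>) N\<^sub>\<phi>"
    and D1: "lipschitz_on_bounded (egrad f) N\<^sub>f"
    and D2: "open N\<^sub>S" "stationary_points Q P1 P2 f \<subseteq> N\<^sub>S"
            "eC1_on (\<lambda>y. ereal (P2 y)) N\<^sub>S"
            "locally_lipschitz_on (egrad (\<lambda>y. ereal (P2 y))) N\<^sub>S"
    and E: "K0 > 0" "\<And>k. k \<ge> K0 \<Longrightarrow> \<delta> k = 0"
    and params: "L < \<gamma>min" "\<And>k. \<gamma>min \<le> \<gamma> k" "\<And>k. \<gamma> k \<le> \<gamma>max"
                "0 \<le> \<sigma>" "\<sigma> < (\<gamma>min - L) / \<gamma>min"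
    and summ: "summable (\<lambda>k. norm (\<Delta> k))"
    and alg: "iBPDCA_SC1 f P1 P2 \<phi> \<gamma> \<sigma> x \<xi> \<Delta> \<delta>"
    and KL: "KL_function (objective Q P1 P2 f)"
  shows "\<exists>a. x \<longlonglongrightarrow> a \<and> l_stationary Q P1 P2 f a"
proof -
  interpret ibpdca Q X N\<^sub>f N\<^sub>\<phi> N\<^sub>S f P1 \<phi> P2 L \<mu> \<gamma>min \<gamma>max \<sigma> \<gamma> \<delta> x \<xi> \<Delta> K0
    by unfold_locales
      (fact Q A1 kernel A2 A3 A4 B C C1 C2 D1 D2 E params summ alg KL)+
  show ?thesis by (rule converges_to_l_stationary)
qed

end
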